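(* Let $m,n\ge 2$, and let $\mathrm{small}_{m,n}$ be the number of small cells in $B_{m,n}$. Then $$\mathrm{small}_{m,n}=2\binom{m}{2}\binom{n}{2}\,r_{m-2,n-2},$$ where $r_{m-2,n-2}$ is the number of regions of the real arrangement $\mathcal{A}_{m-2,n-2}$.
   Context: The map $g:\mathbb{R}^{2(m+n)}\to\mathbb{R}^{m\times n}$ sends $(a,A,b,B)$, with $a,A\in\mathbb{R}^m$ and $b,B\in\mathbb{R}^n$, to the $m\times n$ matrix with entries $g_{ij}=\min(a_i+b_j,\,A_i+B_j)$. Its image is denoted $B_{m,n}$. Put $x_i=a_i-A_i$ and $y_j=B_j-b_j$. Let $\mathcal{A}_{m,n}$ be the hyperplane arrangement in $\mathbb{R}^{2(m+n)}$ consisting of the hyperplanes $x_i=y_j$ for $1\le i\le m$, $1\le j\le n$. Its regions are the connected components of the complement; $r_{m,n}$ is their number (equivalently, the number of acyclic orientations of the complete bipartite graph $K_{m,n}$). If $m=0$ or $n=0$ the arrangement has no hyperplanes and $r_{m,n}=1$. Label of a region. Each region $R$ is described uniquely by an ordered partition of the set of letters $\{1,\dots,m,\overline{1},\dots,\overline{n}\}$ into nonempty blocks, each consisting only of positive letters $i$ (representing $x_i$) or only of negative letters $\overline{j}$ (representing $y_j$), with consecutive blocks of opposite sign: the region is the set of points such that $x_i<y_j$ if the block of $i$ precedes the block of $\overline{j}$, and $x_i>y_j$ otherwise. $\pi(R)$ denotes the permutation of the letters obtained by reading the blocks from left to right, with letters in increasing order within each block. "Blocks of $\pi(R)$" are these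 maximal blocks of consecutive letters of the same sign. A block is a singleton if it has exactly one letter. Cells. For a region $R$, the associated cell is the closed polyhedron $\overline{g(R)}\subset\mathbb{R}^{m\times n}$. It has the maximum possible dimension $2m+2n-4$ if and only if the first and last blocks of $\pi(R)$ are singletons. A cell $\overline{g(R)}$ of maximum dimension is called small if the second and the second-to-last blocks of $\pi(R)$ are both singletons. The small cells are counted as distinct subsets of $\mathbb{R}^{m\times n}$ (different regions may give the same cell; for example $\overline{g(R)}=\overline{g(-R)}$). *)

theory Defs
  imports "HOL-Analysis.Analysis" "HOL-Library.Function_Algebras" "HOL-Library.Disjoint_Sets"
begin

text \<open>
  Since $m$ and $m-2$ (resp. $n$ and $n-2$) occur in the same statement, and $0$ has to be
  allowed, vectors in $\mathbb{R}^k$ are functions on \<^typ>\<open>nat\<close> vanishing outside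
  $\{1,\dots,k\}$, and $m \times n$ matrices are functions on pairs of indices vanishing outside
  $\{1,\dots,m\}\times\{1,\dots,n\}$. These are closed linear subspaces of the function types, and
  the product topology induces the Euclidean topology on them.
\<close>

definition vecs :: "nat \<Rightarrow> (nat \<Rightarrow> real) set" where
  "vecs k = {v. \<forall>i. i \<notin> {1..k} \<longrightarrow> v i = 0}"

type_synonym point =
  "(nat \<Rightarrow> real) \<times> (nat \<Rightarrow> real) \<times> (nat \<Rightarrow> real) \<times> (nat \<Rightarrow> real)"

type_synonym matrix = "nat \<times> nat \<Rightarrow> real"

text \<open>Points are quadruples $(a, A, b, B)$.\<close>

definition points :: "nat \<Rightarrow> nat \<Rightarrow> point set" where
  "points m n = vecs m \<times> vecs m \<times> vecs n \<times> vecs n"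

definition g :: "nat \<Rightarrow> nat \<Rightarrow> point \<Rightarrow> matrix" where
  "g m n = (\<lambda>(a, A, b, B). \<lambda>(i, j).
     if i \<in> {1..m} \<and> j \<in> {1..n} then min (a i + b j) (A i + B j) else 0)"

definition xcoord :: "point \<Rightarrow> nat \<Rightarrow> real" where
  "xcoord = (\<lambda>(a, A, b, B) i. a i - A i)"

definition ycoord :: "point \<Rightarrow> nat \<Rightarrow> real" where
  "ycoord = (\<lambda>(a, A, b, B) j. B j - b j)"

definition arrangement :: "nat \<Rightarrow> nat \<Rightarrow> point set set" where
  "arrangement m n =
     {{p \<in> points m n. xcoord p i = ycoord p j} | i j. i \<in> {1..m} \<and> j \<in> {1..n}}"

definition regions :: "nat \<Rightarrow> nat \<Rightarrow> point set set" where
  "regions m n = components (points m n - \<Union> (arrangement m n))"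

definition num_regions :: "nat \<Rightarrow> nat \<Rightarrow> nat" where
  "num_regions m n = card (regions m n)"

text \<open>The letter $i$ is encoded as \<^term>\<open>Inl i\<close> and the letter $\overline{j}$ as \<^term>\<open>Inr j\<close>.\<close>

type_synonym letter = "nat + nat"

definition alternating_partition :: "nat \<Rightarrow> nat \<Rightarrow> letter set list \<Rightarrow> bool" where
  "alternating_partition m n bs \<longleftrightarrow>
     distinct bs \<and> partition_on ({1..m} <+> {1..n}) (set bs) \<and>
     (\<forall>C \<in> set bs. C \<subseteq> range Inl \<or> C \<subseteq> range Inr) \<and>
     (\<forall>k. Suc k < length bs \<longrightarrow> (bs ! k \<subseteq> range Inl \<longleftrightarrow> bs ! Suc k \<subseteq> range Inr))"

definition precedes :: "letter set list \<Rightarrow> letter \<Rightarrow> letter \<Rightarrow> bool" where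
  "precedes bs u v \<longleftrightarrow> (\<exists>k l. k < l \<and> l < length bs \<and> u \<in> bs ! k \<and> v \<in> bs ! l)"

text \<open>
  \<^term>\<open>bs\<close> is the list of blocks of the label $\pi(R)$. The permutation itself (each block written
  in increasing order) carries no further information: consecutive blocks have opposite signs, so
  these are exactly its maximal runs of letters of equal sign.
\<close>

definition label_blocks :: "nat \<Rightarrow> nat \<Rightarrow> point set \<Rightarrow> letter set list \<Rightarrow> bool" where
  "label_blocks m n R bs \<longleftrightarrow> alternating_partition m n bs \<and>
     R = {p \<in> points m n. \<forall>i \<in> {1..m}. \<forall>j \<in> {1..n}.
            if precedes bs (Inl i) (Inr j) then xcoord p i < ycoord p j
            else xcoord p i > ycoord p j}"

definition cell :: "nat \<Rightarrow> nat \<Rightarrow> point set \<Rightarrow> matrix set" where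
  "cell m n R = closure (g m n ` R)"

interpretation matrix: vector_space "\<lambda>(c::real) (M::matrix) k. c * M k"
  by unfold_locales (auto simp: fun_eq_iff algebra_simps)

text \<open>
  The dimension of the affine hull of a nonempty set, i.e. of the linear span of its differences.
  The constant \<^term>\<open>aff_dim\<close> is not available here, as function types are not Euclidean spaces.
\<close>

definition affine_dim :: "matrix set \<Rightarrow> nat" where
  "affine_dim S = matrix.dim {M - N | M N. M \<in> S \<and> N \<in> S}"

definition small_cells :: "nat \<Rightarrow> nat \<Rightarrow> matrix set set" where
  "small_cells m n = {cell m n R | R bs.
     R \<in> regions m n \<and> label_blocks m n R bs \<and>
     affine_dim (cell m n R) = 2 * m + 2 * n - 4 \<and>
     is_singleton (bs ! 1) \<and> is_singleton (bs ! (length bs - 2))}"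

end

theory Submission
  imports Defs
begin

text \<open>
  A region is determined by the set \<open>S\<close> of pairs \<open>(i, j)\<close> with \<open>x\<^sub>i < y\<^sub>j\<close>; the sets that occur
  are those whose rows form a chain under inclusion (Ferrers relations). Since
  \<open>g\<^sub>i\<^sub>j = A\<^sub>i + b\<^sub>j + min x\<^sub>i y\<^sub>j\<close>, the \<open>2 \<times> 2\<close> tropical minor
  \<open>M\<^sub>i\<^sub>j + M\<^sub>k\<^sub>l - M\<^sub>i\<^sub>l - M\<^sub>k\<^sub>j\<close> of a point of the image is, up to sign, the length of the overlap
  of the intervals \<open>[x\<^sub>i, x\<^sub>k]\<close> and \<open>[y\<^sub>j, y\<^sub>l]\<close>. The minors which are nonnegative but not
  identically zero on a small cell determine, up to reversal of the label, the first two and last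
  two letters and the restriction of \<open>S\<close> to the remaining letters. Conversely, every Ferrers
  relation on the remaining letters occurs, and the two outermost letters can be ordered at each
  end in only one way that makes the second and second-to-last blocks singletons; the sole
  exception is \<open>m = n = 2\<close>, where the two possible orders give the same cell. Choosing the
  representative with \<open>i1 < i2\<close> for the first and last positive letters leaves
  \<open>binomial(m, 2)\<close> choices of positive and \<open>2 binomial(n, 2)\<close> choices of negative letters.
\<close>

section \<open>Regions and Ferrers relations\<close>

definition ferrers :: "nat set \<Rightarrow> nat set \<Rightarrow> (nat \<times> nat) set set" where
  "ferrers I J = {S. S \<subseteq> I \<times> J \<and>
     (\<forall>i j k l. (i, j) \<in> S \<longrightarrow> (k, l) \<in> S \<longrightarrow> (i, l) \<in> S \<or> (k, j) \<in> S)}"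

definition region :: "nat \<Rightarrow> nat \<Rightarrow> (nat \<times> nat) set \<Rightarrow> point set" where
  "region m n S = {p \<in> points m n. \<forall>i \<in> {1..m}. \<forall>j \<in> {1..n}.
     if (i, j) \<in> S then xcoord p i < ycoord p j else xcoord p i > ycoord p j}"

definition sign_rel :: "nat \<Rightarrow> nat \<Rightarrow> point \<Rightarrow> (nat \<times> nat) set" where
  "sign_rel m n p = {(i, j). i \<in> {1..m} \<and> j \<in> {1..n} \<and> xcoord p i < ycoord p j}"

definition row_less :: "nat set \<Rightarrow> (nat \<times> nat) set \<Rightarrow> nat \<Rightarrow> nat \<Rightarrow> bool" where
  "row_less J S i k \<longleftrightarrow> (\<exists>j \<in> J. (i, j) \<in> S \<and> (k, j) \<notin> S)"

definition col_less :: "nat set \<Rightarrow> (nat \<times> nat) set \<Rightarrow> nat \<Rightarrow> nat \<Rightarrow> bool" where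
  "col_less I S j l \<longleftrightarrow> (\<exists>i \<in> I. (i, j) \<notin> S \<and> (i, l) \<in> S)"

text \<open>The order of the blocks of the label, expressed through \<open>S\<close>: two letters of the same sign
  are in different blocks iff a letter of the opposite sign lies between them.\<close>

fun letter_less :: "nat set \<Rightarrow> nat set \<Rightarrow> (nat \<times> nat) set \<Rightarrow> letter \<Rightarrow> letter \<Rightarrow> bool" where
  "letter_less I J S (Inl i) (Inr j) \<longleftrightarrow> (i, j) \<in> S"
| "letter_less I J S (Inr j) (Inl i) \<longleftrightarrow> (i, j) \<notin> S"
| "letter_less I J S (Inl i) (Inl k) \<longleftrightarrow> row_less J S i k"
| "letter_less I J S (Inr j) (Inr l) \<longleftrightarrow> col_less I S j l"

definition rank :: "nat set \<Rightarrow> nat set \<Rightarrow> (nat \<times> nat) set \<Rightarrow> letter \<Rightarrow> nat" where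
  "rank I J S u = card {v \<in> I <+> J. letter_less I J S v u}"

lemma ferrersD:
  assumes "S \<in> ferrers I J" "(i, j) \<in> S" "(k, l) \<in> S" "(i, l) \<notin> S"
  shows "(k, j) \<in> S"
  using assms unfolding ferrers_def by blast

lemma ferrers_subset: "S \<in> ferrers I J \<Longrightarrow> S \<subseteq> I \<times> J"
  unfolding ferrers_def by blast

lemma letter_less_asym:
  assumes S: "S \<in> ferrers I J" and "letter_less I J S u v"
  shows "\<not> letter_less I J S v u"
  using assms(2)
  by (cases u; cases v) (auto simp: row_less_def col_less_def dest: ferrersD[OF S])

lemma letter_less_cotrans:
  assumes S: "S \<in> ferrers I J"
    and "u \<in> I <+> J" "v \<in> I <+> J" "w \<in> I <+> J" and "letter_less I J S u w"
  shows "letter_less I J S u v \<or> letter_less I J S v w"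
  using assms(2-)
  by (cases u; cases v; cases w) (auto simp: row_less_def col_less_def dest: ferrersD[OF S])

lemma rank_less_iff:
  assumes S: "S \<in> ferrers I J" and fin: "finite I" "finite J"
    and u: "u \<in> I <+> J" and v: "v \<in> I <+> J"
  shows "rank I J S u < rank I J S v \<longleftrightarrow> letter_less I J S u v"
proof
  assume "letter_less I J S u v"
  then have "{w \<in> I <+> J. letter_less I J S w u} \<subset> {w \<in> I <+> J. letter_less I J S w v}"
    using letter_less_asym[OF S] letter_less_cotrans[OF S] u v by blast
  then show "rank I J S u < rank I J S v"
    unfolding rank_def using fin by (intro psubset_card_mono) auto
next
  assume less: "rank I J S u < rank I J S v"
  show "letter_less I J S u v"
  proof (rule ccontr)
    assume "\<not> letter_less I J S u v"
    then have "{w \<in> I <+> J. letter_less I J S w v} \<subseteq> {w \<in> I <+> J. letter_less I J S w u}"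
      using letter_less_cotrans[OF S] u v by blast
    then have "rank I J S v \<le> rank I J S u"
      unfolding rank_def using fin by (intro card_mono) auto
    then show False using less by simp
  qed
qed

definition coord_point :: "nat \<Rightarrow> nat \<Rightarrow> (nat \<Rightarrow> real) \<Rightarrow> (nat \<Rightarrow> real) \<Rightarrow> point" where
  "coord_point m n x y =
     ((\<lambda>i. if i \<in> {1..m} then x i else 0), 0, 0, (\<lambda>j. if j \<in> {1..n} then y j else 0))"

lemma coord_point:
  "coord_point m n x y \<in> points m n"
  "i \<in> {1..m} \<Longrightarrow> xcoord (coord_point m n x y) i = x i"
  "j \<in> {1..n} \<Longrightarrow> ycoord (coord_point m n x y) j = y j"
  by (auto simp: coord_point_def points_def vecs_def xcoord_def ycoord_def)

text \<open>The factor 3 leaves room for perturbing each coordinate by 1 without leaving the region.\<close>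

definition rank_point :: "nat \<Rightarrow> nat \<Rightarrow> (nat \<times> nat) set \<Rightarrow> point" where
  "rank_point m n S = coord_point m n
     (\<lambda>i. 3 * real (rank {1..m} {1..n} S (Inl i))) (\<lambda>j. 3 * real (rank {1..m} {1..n} S (Inr j)))"

lemma rank_point_gap:
  assumes S: "S \<in> ferrers {1..m} {1..n}" and "i \<in> {1..m}" "j \<in> {1..n}"
  shows "if (i, j) \<in> S then xcoord (rank_point m n S) i + 3 \<le> ycoord (rank_point m n S) j
    else ycoord (rank_point m n S) j + 3 \<le> xcoord (rank_point m n S) i"
proof -
  let ?r = "rank {1..m} {1..n} S"
  have "Inl i \<in> {1..m} <+> {1..n}" "Inr j \<in> {1..m} <+> {1..n}" using assms by auto
  then have "(i, j) \<in> S \<Longrightarrow> ?r (Inl i) < ?r (Inr j)" "(i, j) \<notin> S \<Longrightarrow> ?r (Inr j) < ?r (Inl i)"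
    by (simp_all add: rank_less_iff[OF S] del: One_nat_def)
  then have "(i, j) \<in> S \<Longrightarrow> real (?r (Inl i)) + 1 \<le> real (?r (Inr j))"
    "(i, j) \<notin> S \<Longrightarrow> real (?r (Inr j)) + 1 \<le> real (?r (Inl i))"
    by linarith+
  then show ?thesis using assms by (auto simp: rank_point_def coord_point)
qed

lemma rank_point_in_region:
  assumes "S \<in> ferrers {1..m} {1..n}"
  shows "rank_point m n S \<in> region m n S"
proof -
  have "rank_point m n S \<in> points m n" by (simp add: rank_point_def coord_point)
  moreover have "if (i, j) \<in> S then xcoord (rank_point m n S) i < ycoord (rank_point m n S) j
    else ycoord (rank_point m n S) j < xcoord (rank_point m n S) i"
    if "i \<in> {1..m}" "j \<in> {1..n}" for i j
    using rank_point_gap[OF assms that] by (auto split: if_splits)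
  ultimately show ?thesis unfolding region_def by simp
qed

lemma sign_rel_ferrers: "sign_rel m n p \<in> ferrers {1..m} {1..n}"
  unfolding sign_rel_def ferrers_def by auto

lemma sign_rel_region:
  assumes "S \<subseteq> {1..m} \<times> {1..n}" "p \<in> region m n S"
  shows "sign_rel m n p = S"
proof (rule set_eqI)
  fix t :: "nat \<times> nat"
  obtain i j where t: "t = (i, j)" by (cases t)
  show "t \<in> sign_rel m n p \<longleftrightarrow> t \<in> S"
  proof (cases "i \<in> {1..m} \<and> j \<in> {1..n}")
    case True
    then have "if (i, j) \<in> S then xcoord p i < ycoord p j else xcoord p i > ycoord p j"
      using assms(2) unfolding region_def by blast
    then show ?thesis using True t by (auto simp: sign_rel_def split: if_splits)
  next
    case False
    then show ?thesis using assms(1) t by (auto simp: sign_rel_def)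
  qed
qed

lemma in_region_sign_rel:
  assumes "p \<in> points m n - \<Union> (arrangement m n)"
  shows "p \<in> region m n (sign_rel m n p)"
proof -
  have "xcoord p i \<noteq> ycoord p j" if "i \<in> {1..m}" "j \<in> {1..n}" for i j
    using assms that unfolding arrangement_def by blast
  then show ?thesis using assms unfolding region_def sign_rel_def by (auto simp: not_less less_le)
qed

lemma region_subset: "region m n S \<subseteq> points m n - \<Union> (arrangement m n)"
proof -
  have "xcoord p i \<noteq> ycoord p j" if "p \<in> region m n S" "i \<in> {1..m}" "j \<in> {1..n}" for p i j
    using that unfolding region_def by (metis (no_types, lifting) less_irrefl mem_Collect_eq)
  then show ?thesis unfolding arrangement_def region_def by blast
qed

lemma continuous_on_xcoord: "continuous_on T (\<lambda>p. xcoord p i)"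
  and continuous_on_ycoord: "continuous_on T (\<lambda>p. ycoord p i)"
  unfolding xcoord_def ycoord_def case_prod_beta
  by (intro continuous_intros continuous_on_product_then_coordinatewise)+

lemma connected_region: "connected (region m n S)"
proof -
  have "\<exists>T. connected T \<and> T \<subseteq> region m n S \<and> p \<in> T \<and> q \<in> T"
    if p: "p \<in> region m n S" and q: "q \<in> region m n S" for p q
  proof -
    obtain a A b B where p_eq: "p = (a, A, b, B)" by (cases p)
    obtain a' A' b' B' where q_eq: "q = (a', A', b', B')" by (cases q)
    define mix :: "(nat \<Rightarrow> real) \<Rightarrow> (nat \<Rightarrow> real) \<Rightarrow> real \<Rightarrow> nat \<Rightarrow> real"
      where "mix v w t i = (1 - t) * v i + t * w i" for v w t i
    define h where "h t = (mix a a' t, mix A A' t, mix b b' t, mix B B' t)" for t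
    have mix: "continuous_on {0..1} (mix v w)" for v w
      unfolding mix_def by (intro continuous_on_coordinatewise_then_product continuous_intros)
    have "connected (h ` {0..1})"
      unfolding h_def by (intro connected_continuous_image continuous_on_Pair mix) auto
    moreover have "h ` {0..1} \<subseteq> region m n S"
    proof (rule image_subsetI)
      fix t :: real assume t: "t \<in> {0..1}"
      have "h t \<in> points m n"
        using p q by (auto simp: p_eq q_eq h_def region_def points_def vecs_def mix_def)
      moreover have "if (i, j) \<in> S then xcoord (h t) i < ycoord (h t) j
          else xcoord (h t) i > ycoord (h t) j" if ij: "i \<in> {1..m}" "j \<in> {1..n}" for i j
      proof -
        have 1: "xcoord (h t) i = (1 - t) * xcoord p i + t * xcoord q i"
          "ycoord (h t) j = (1 - t) * ycoord p j + t * ycoord q j"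
          by (simp_all add: h_def mix_def xcoord_def ycoord_def p_eq q_eq algebra_simps)
        have 2: "(1 - t) * c + t * d < (1 - t) * c' + t * d'" if "c < c'" "d < d'" for c c' d d' :: real
        proof (cases "t = 0")
          case False
          then show ?thesis using t that by (intro add_le_less_mono mult_left_mono mult_strict_left_mono) auto
        qed (use that in auto)
        have "if (i, j) \<in> S then xcoord p i < ycoord p j else xcoord p i > ycoord p j"
          "if (i, j) \<in> S then xcoord q i < ycoord q j else xcoord q i > ycoord q j"
          using p q ij unfolding region_def by blast+
        then show ?thesis unfolding 1
          using 2[of "xcoord p i" "ycoord p j" "xcoord q i" "ycoord q j"]
            2[of "ycoord p j" "xcoord p i" "ycoord q j" "xcoord q i"] by presburger
      qed
      ultimately show "h t \<in> region m n S" unfolding region_def by blast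
    qed
    moreover have "h 0 = p" "h 1 = q" by (auto simp: h_def mix_def p_eq q_eq)
    then have "p \<in> h ` {0..1}" "q \<in> h ` {0..1}"
      by (auto intro: rev_image_eqI[of 0] rev_image_eqI[of 1])
    ultimately show ?thesis by (intro exI[of _ "h ` {0..1}"]) simp
  qed
  then have "\<forall>p \<in> region m n S. \<forall>q \<in> region m n S. connected_component (region m n S) p q"
    unfolding connected_component_def by simp
  then show ?thesis by (rule connected_iff_connected_component[THEN iffD2])
qed

lemma connected_component_region:
  assumes p: "p \<in> points m n - \<Union> (arrangement m n)" (is "p \<in> ?U")
  shows "connected_component_set ?U p = region m n (sign_rel m n p)"
proof
  show "region m n (sign_rel m n p) \<subseteq> connected_component_set ?U p"
    by (intro connected_component_maximal in_region_sign_rel[OF p] connected_region region_subset)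
  show "connected_component_set ?U p \<subseteq> region m n (sign_rel m n p)"
  proof
    fix q assume "q \<in> connected_component_set ?U p"
    then obtain C where C: "connected C" "C \<subseteq> ?U" "p \<in> C" "q \<in> C"
      by (auto simp: connected_component_def)
    have "xcoord p i < ycoord p j \<longleftrightarrow> xcoord q i < ycoord q j"
      if ij: "i \<in> {1..m}" "j \<in> {1..n}" for i j
    proof (rule ccontr)
      assume neq: "\<not> ?thesis"
      let ?h = "\<lambda>p. xcoord p i - ycoord p j"
      have "connected (?h ` C)"
        by (rule connected_continuous_image[OF continuous_on_diff[OF continuous_on_xcoord
                continuous_on_ycoord] C(1)])
      moreover have "?h p \<in> ?h ` C" "?h q \<in> ?h ` C" using C by auto
      moreover have "?h p \<le> 0 \<and> 0 \<le> ?h q \<or> ?h q \<le> 0 \<and> 0 \<le> ?h p"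
        using neq by auto
      ultimately have "0 \<in> ?h ` C"
        using connectedD_interval[of "?h ` C" "?h p" "?h q" 0]
          connectedD_interval[of "?h ` C" "?h q" "?h p" 0] by blast
      then obtain r where r: "r \<in> C" "xcoord r i = ycoord r j" by auto
      then have "r \<in> points m n - \<Union> (arrangement m n)" using C(2) by blast
      then have "r \<in> points m n" "r \<notin> \<Union> (arrangement m n)" by blast+
      moreover have "{p \<in> points m n. xcoord p i = ycoord p j} \<in> arrangement m n"
        using ij unfolding arrangement_def by blast
      ultimately show False using r by blast
    qed
    then have "sign_rel m n q = sign_rel m n p" by (auto simp: sign_rel_def)
    moreover have "q \<in> ?U" using C by blast
    ultimately show "q \<in> region m n (sign_rel m n p)" using in_region_sign_rel[of q m n] by argo
  qed
qed

lemma regions_eq: "regions m n = region m n ` ferrers {1..m} {1..n}"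
proof -
  let ?U = "points m n - \<Union> (arrangement m n)"
  have "regions m n = connected_component_set ?U ` ?U"
    unfolding regions_def components_def by simp
  also have "\<dots> = (\<lambda>p. region m n (sign_rel m n p)) ` ?U"
    using connected_component_region by (intro image_cong) auto
  also have "\<dots> = region m n ` sign_rel m n ` ?U" by (simp add: image_image)
  also have "sign_rel m n ` ?U = ferrers {1..m} {1..n}"
  proof
    show "ferrers {1..m} {1..n} \<subseteq> sign_rel m n ` ?U"
    proof
      fix S assume S: "S \<in> ferrers {1..m} {1..n}"
      then have "sign_rel m n (rank_point m n S) = S"
        by (intro sign_rel_region[OF ferrers_subset] rank_point_in_region)
      then show "S \<in> sign_rel m n ` ?U"
        using subsetD[OF region_subset rank_point_in_region[OF S]] by (metis image_eqI)
    qed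
  qed (use sign_rel_ferrers in auto)
  finally show ?thesis .
qed

lemma inj_on_region: "inj_on (region m n) (ferrers {1..m} {1..n})"
proof (rule inj_onI)
  fix S S' assume S: "S \<in> ferrers {1..m} {1..n}" "S' \<in> ferrers {1..m} {1..n}"
    and eq: "region m n S = region m n S'"
  have "rank_point m n S \<in> region m n S'" using rank_point_in_region[OF S(1)] eq by simp
  then show "S = S'"
    using sign_rel_region[OF ferrers_subset[OF S(1)] rank_point_in_region[OF S(1)]]
      sign_rel_region[OF ferrers_subset[OF S(2)]] by simp
qed

lemma num_regions_eq: "num_regions m n = card (ferrers {1..m} {1..n})"
  unfolding num_regions_def regions_eq by (rule card_image[OF inj_on_region])

section \<open>Labels of regions\<close>

definition label_rel :: "nat \<Rightarrow> nat \<Rightarrow> letter set list \<Rightarrow> (nat \<times> nat) set" where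
  "label_rel m n bs = {(i, j). i \<in> {1..m} \<and> j \<in> {1..n} \<and> precedes bs (Inl i) (Inr j)}"

definition block_index :: "letter set list \<Rightarrow> letter \<Rightarrow> nat" where
  "block_index bs u = (THE k. k < length bs \<and> u \<in> bs ! k)"

lemma label_blocks_iff:
  "label_blocks m n R bs \<longleftrightarrow> alternating_partition m n bs \<and> R = region m n (label_rel m n bs)"
proof -
  have "region m n (label_rel m n bs) = {p \<in> points m n. \<forall>i \<in> {1..m}. \<forall>j \<in> {1..n}.
            if precedes bs (Inl i) (Inr j) then xcoord p i < ycoord p j
            else xcoord p i > ycoord p j}"
    unfolding region_def label_rel_def by (intro Collect_cong conj_cong refl ball_cong) simp
  then show ?thesis unfolding label_blocks_def by simp
qed

lemma block_index:
  assumes "alternating_partition m n bs" and "u \<in> {1..m} <+> {1..n}"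
  shows "block_index bs u < length bs" "u \<in> bs ! block_index bs u"
proof -
  have p: "partition_on ({1..m} <+> {1..n}) (set bs)" "distinct bs"
    using assms(1) unfolding alternating_partition_def by auto
  have "u \<in> \<Union> (set bs)" using p(1) assms(2) unfolding partition_on_def by argo
  then obtain C where "C \<in> set bs" "u \<in> C" by blast
  then obtain k where k: "k < length bs" "u \<in> bs ! k" by (metis in_set_conv_nth)
  have "l = k" if "l < length bs" "u \<in> bs ! l" for l
  proof -
    have "bs ! l = bs ! k"
      using p(1) that k unfolding partition_on_def disjoint_def by (metis IntI empty_iff nth_mem)
    then show ?thesis using p(2) that k by (simp add: nth_eq_iff_index_eq)
  qed
  then have "block_index bs u = k"
    unfolding block_index_def using k by blast
  then show "block_index bs u < length bs" "u \<in> bs ! block_index bs u" using k by auto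
qed

lemma block_index_unique:
  assumes "alternating_partition m n bs" and "k < length bs" "u \<in> bs ! k"
  shows "u \<in> {1..m} <+> {1..n}" "block_index bs u = k"
proof -
  have p: "partition_on ({1..m} <+> {1..n}) (set bs)" "distinct bs"
    using assms(1) unfolding alternating_partition_def by auto
  show u: "u \<in> {1..m} <+> {1..n}"
    using p(1) assms(2,3) unfolding partition_on_def by (metis UnionI nth_mem)
  let ?l = "block_index bs u"
  have l: "?l < length bs" "u \<in> bs ! ?l" using block_index[OF assms(1) u] .
  have "bs ! ?l = bs ! k"
    using p(1) l assms(2,3) unfolding partition_on_def disjoint_def by (metis IntI empty_iff nth_mem)
  then show "?l = k" using p(2) l assms(2) by (simp add: nth_eq_iff_index_eq)
qed

lemma block_nonempty:
  assumes "alternating_partition m n bs" and "k < length bs"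
  obtains u where "u \<in> bs ! k"
  using assms unfolding alternating_partition_def partition_on_def by (metis all_not_in_conv nth_mem)

lemma block_mono:
  assumes "alternating_partition m n bs" and "k < length bs"
  shows "bs ! k \<subseteq> range Inl \<or> bs ! k \<subseteq> range Inr"
  using assms unfolding alternating_partition_def by (meson nth_mem)

lemma precedes_iff:
  assumes "alternating_partition m n bs" and "u \<in> {1..m} <+> {1..n}" "v \<in> {1..m} <+> {1..n}"
  shows "precedes bs u v \<longleftrightarrow> block_index bs u < block_index bs v"
  unfolding precedes_def using block_index[OF assms(1,2)] block_index[OF assms(1,3)]
    block_index_unique(2)[OF assms(1)] by (metis order.strict_trans)

lemma block_index_Inl_Inr:
  assumes "alternating_partition m n bs" and "i \<in> {1..m}" "j \<in> {1..n}"
  shows "block_index bs (Inl i) \<noteq> block_index bs (Inr j)"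
proof
  assume eq: "block_index bs (Inl i) = block_index bs (Inr j)"
  have "Inl i \<in> {1..m} <+> {1..n}" "Inr j \<in> {1..m} <+> {1..n}" using assms by auto
  from block_index[OF assms(1) this(1)] block_index[OF assms(1) this(2)]
  show False using eq block_mono[OF assms(1)] by (metis imageE sum.distinct(1) subsetD)
qed

lemma label_rel_iff:
  assumes "alternating_partition m n bs" and "i \<in> {1..m}" "j \<in> {1..n}"
  shows "(i, j) \<in> label_rel m n bs \<longleftrightarrow> block_index bs (Inl i) < block_index bs (Inr j)"
    "(i, j) \<notin> label_rel m n bs \<longleftrightarrow> block_index bs (Inr j) < block_index bs (Inl i)"
proof -
  show 1: "(i, j) \<in> label_rel m n bs \<longleftrightarrow> block_index bs (Inl i) < block_index bs (Inr j)"
    using assms precedes_iff[OF assms(1) InlI InrI, of i j] unfolding label_rel_def by blast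
  show "(i, j) \<notin> label_rel m n bs \<longleftrightarrow> block_index bs (Inr j) < block_index bs (Inl i)"
    using block_index_Inl_Inr[OF assms] unfolding 1 by auto
qed

lemma label_rel_ferrers:
  assumes "alternating_partition m n bs"
  shows "label_rel m n bs \<in> ferrers {1..m} {1..n}"
proof -
  have sub: "label_rel m n bs \<subseteq> {1..m} \<times> {1..n}" unfolding label_rel_def by auto
  moreover have "(i, l) \<in> label_rel m n bs \<or> (k, j) \<in> label_rel m n bs"
    if a: "(i, j) \<in> label_rel m n bs" "(k, l) \<in> label_rel m n bs" for i j k l
  proof -
    have r: "i \<in> {1..m}" "k \<in> {1..m}" "j \<in> {1..n}" "l \<in> {1..n}" using a sub by auto
    show ?thesis using a r
      unfolding label_rel_iff(1)[OF assms r(1,3)] label_rel_iff(1)[OF assms r(2,4)]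
        label_rel_iff(1)[OF assms r(1,4)] label_rel_iff(1)[OF assms r(2,3)] by linarith
  qed
  ultimately show ?thesis unfolding ferrers_def by blast
qed

lemma alternating_next:
  assumes bs: "alternating_partition m n bs" and k: "Suc k < length bs"
  shows "bs ! k \<subseteq> range Inl \<longleftrightarrow> bs ! Suc k \<subseteq> range Inr"
  using assms unfolding alternating_partition_def by blast

lemma range_Inl_Inr: "A \<subseteq> range Inl \<Longrightarrow> A \<subseteq> range Inr \<Longrightarrow> A = {}"
  by fastforce

lemma block_between_Inl:
  assumes bs: "alternating_partition m n bs" and "i \<in> {1..m}" "k \<in> {1..m}"
    and less: "block_index bs (Inl i) < block_index bs (Inl k)"
  shows "row_less {1..n} (label_rel m n bs) i k"
proof -
  have u: "Inl i \<in> {1..m} <+> {1..n}" and v: "Inl k \<in> {1..m} <+> {1..n}" using assms by auto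
  let ?b = "Suc (block_index bs (Inl i))"
  have b: "?b < length bs" using less block_index(1)[OF bs v] by simp
  have "bs ! block_index bs (Inl i) \<subseteq> range Inl"
    using block_mono[OF bs block_index(1)[OF bs u]] block_index(2)[OF bs u] by blast
  then have N: "bs ! ?b \<subseteq> range Inr" using alternating_next[OF bs b] by simp
  obtain w where w: "w \<in> bs ! ?b" using block_nonempty[OF bs b] .
  then obtain j where j: "w = Inr j" using N by blast
  have idx: "block_index bs (Inr j) = ?b" and "Inr j \<in> {1..m} <+> {1..n}"
    using block_index_unique[OF bs b w] j by auto
  then have j': "j \<in> {1..n}" by auto
  have "block_index bs (Inl k) \<noteq> ?b" using block_index_Inl_Inr[OF bs assms(3) j'] idx by simp
  then have "(i, j) \<in> label_rel m n bs" "(k, j) \<notin> label_rel m n bs"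
    using less idx label_rel_iff[OF bs] assms(2,3) j' by auto
  then show ?thesis using j' unfolding row_less_def by blast
qed

lemma block_between_Inr:
  assumes bs: "alternating_partition m n bs" and "j \<in> {1..n}" "l \<in> {1..n}"
    and less: "block_index bs (Inr j) < block_index bs (Inr l)"
  shows "col_less {1..m} (label_rel m n bs) j l"
proof -
  have u: "Inr j \<in> {1..m} <+> {1..n}" and v: "Inr l \<in> {1..m} <+> {1..n}" using assms by auto
  let ?b = "Suc (block_index bs (Inr j))"
  have b: "?b < length bs" using less block_index(1)[OF bs v] by simp
  have "\<not> bs ! block_index bs (Inr j) \<subseteq> range Inl"
    using block_index(2)[OF bs u] by blast
  then have N: "bs ! ?b \<subseteq> range Inl" using alternating_next[OF bs b] block_mono[OF bs b] by simp
  obtain w where w: "w \<in> bs ! ?b" using block_nonempty[OF bs b] .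
  then obtain i where i: "w = Inl i" using N by blast
  have idx: "block_index bs (Inl i) = ?b" and "Inl i \<in> {1..m} <+> {1..n}"
    using block_index_unique[OF bs b w] i by auto
  then have i': "i \<in> {1..m}" by auto
  have "block_index bs (Inr l) \<noteq> ?b" using block_index_Inl_Inr[OF bs i' assms(3)] idx by simp
  then have "(i, j) \<notin> label_rel m n bs" "(i, l) \<in> label_rel m n bs"
    using less idx label_rel_iff[OF bs i'] assms(2,3) by auto
  then show ?thesis using i' unfolding col_less_def by blast
qed

lemma label_exists:
  assumes S: "S \<in> ferrers {1..m} {1..n}"
  obtains bs where "alternating_partition m n bs" "label_rel m n bs = S"
proof -
  let ?L = "{1..m} <+> {1..n}"
  let ?r = "rank {1..m} {1..n} S"
  define F where "F k = {u \<in> ?L. ?r u = k}" for k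
  define ks where "ks = sorted_list_of_set (?r ` ?L)"
  define bs where "bs = map F ks"
  have ks: "set ks = ?r ` ?L" "distinct ks" "sorted_wrt (<) ks"
    unfolding ks_def by auto
  have len: "length bs = length ks" unfolding bs_def by simp
  have nth: "bs ! k = F (ks ! k)" if "k < length ks" for k using that unfolding bs_def by simp
  have mono: "ks ! k < ks ! l \<longleftrightarrow> k < l" if "k < length ks" "l < length ks" for k l
    using that ks(3) by (metis linorder_neqE_nat order_less_asym sorted_wrt_nth_less)
  have less: "?r u < ?r v \<longleftrightarrow> letter_less {1..m} {1..n} S u v" if "u \<in> ?L" "v \<in> ?L" for u v
    using rank_less_iff[OF S _ _ that] by simp
  have neq: "?r (Inl i) \<noteq> ?r (Inr j)" if "Inl i \<in> ?L" "Inr j \<in> ?L" for i j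
    using less[OF that] less[OF that(2,1)] by auto
  have F_nonempty: "F k \<noteq> {}" if "k \<in> set ks" for k using that unfolding ks F_def by blast
  have F_mono: "F k \<subseteq> range Inl \<or> F k \<subseteq> range Inr" for k
  proof (rule ccontr)
    assume "\<not> ?thesis"
    then obtain u v where "u \<in> F k" "u \<notin> range Inl" "v \<in> F k" "v \<notin> range Inr" by blast
    moreover then obtain j i where "u = Inr j" "v = Inl i" by (metis rangeI sum.exhaust)
    ultimately show False using neq unfolding F_def by auto
  qed
  have gap: False if "Suc k < length ks" "w \<in> ?L" "ks ! k < ?r w" "?r w < ks ! Suc k" for k w
  proof -
    have "?r w \<in> set ks" using that(2) unfolding ks by blast
    then obtain t where t: "t < length ks" "?r w = ks ! t" by (metis in_set_conv_nth)
    have "k < t" "t < Suc k"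
      using that t mono[of k t] mono[of t "Suc k"] by auto
    then show False by simp
  qed
  have alt: "F (ks ! k) \<subseteq> range Inl \<longleftrightarrow> F (ks ! Suc k) \<subseteq> range Inr" if k: "Suc k < length ks" for k
  proof -
    have ne: "F (ks ! k) \<noteq> {}" "F (ks ! Suc k) \<noteq> {}" using F_nonempty k by auto
    have lt: "ks ! k < ks ! Suc k" using mono[of k "Suc k"] k by simp
    have no_Inl: "\<not> (F (ks ! k) \<subseteq> range Inl \<and> F (ks ! Suc k) \<subseteq> range Inl)"
    proof
      assume *: "F (ks ! k) \<subseteq> range Inl \<and> F (ks ! Suc k) \<subseteq> range Inl"
      then obtain i l where il: "Inl i \<in> F (ks ! k)" "Inl l \<in> F (ks ! Suc k)" using ne by blast
      then have L: "Inl i \<in> ?L" "?r (Inl i) = ks ! k" "Inl l \<in> ?L" "?r (Inl l) = ks ! Suc k"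
        unfolding F_def by auto
      then obtain j where j: "j \<in> {1..n}" "(i, j) \<in> S" "(l, j) \<notin> S"
        using less[OF L(1,3)] lt unfolding letter_less.simps row_less_def by auto
      then have "Inr j \<in> ?L" by auto
      then show False using gap[OF k, of "Inr j"] L less[OF L(1), of "Inr j"] less[OF _ L(3), of "Inr j"] j
        by auto
    qed
    have no_Inr: "\<not> (F (ks ! k) \<subseteq> range Inr \<and> F (ks ! Suc k) \<subseteq> range Inr)"
    proof
      assume *: "F (ks ! k) \<subseteq> range Inr \<and> F (ks ! Suc k) \<subseteq> range Inr"
      then obtain i l where il: "Inr i \<in> F (ks ! k)" "Inr l \<in> F (ks ! Suc k)" using ne by blast
      then have L: "Inr i \<in> ?L" "?r (Inr i) = ks ! k" "Inr l \<in> ?L" "?r (Inr l) = ks ! Suc k"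
        unfolding F_def by auto
      then obtain j where j: "j \<in> {1..m}" "(j, i) \<notin> S" "(j, l) \<in> S"
        using less[OF L(1,3)] lt unfolding letter_less.simps col_less_def by auto
      then have "Inl j \<in> ?L" by auto
      then show False using gap[OF k, of "Inl j"] L less[OF L(1), of "Inl j"] less[OF _ L(3), of "Inl j"] j
        by auto
    qed
    show ?thesis
      using no_Inl no_Inr F_mono[of "ks ! k"] F_mono[of "ks ! Suc k"] ne range_Inl_Inr by metis
  qed
  have part: "partition_on ?L (set bs)"
  proof (rule partition_onI)
    show "\<Union> (set bs) = ?L"
      unfolding bs_def by (auto simp: ks F_def)
    show "disjnt p q" if "p \<in> set bs" "q \<in> set bs" "p \<noteq> q" for p q
      using that unfolding bs_def F_def disjnt_def by auto
    show "{} \<notin> set bs" using F_nonempty unfolding bs_def by auto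
  qed
  have "inj_on F (set ks)" unfolding inj_on_def ks F_def by blast
  then have "distinct bs" unfolding bs_def using ks by (simp add: distinct_map)
  then have alternating: "alternating_partition m n bs"
    unfolding alternating_partition_def using part F_mono alt nth len by (auto simp: bs_def)
  have "(i, j) \<in> label_rel m n bs \<longleftrightarrow> (i, j) \<in> S" if ij: "i \<in> {1..m}" "j \<in> {1..n}" for i j
  proof -
    have L: "Inl i \<in> ?L" "Inr j \<in> ?L" using ij by auto
    have idx: "block_index bs u < length ks \<and> ks ! block_index bs u = ?r u" if "u \<in> ?L" for u
    proof -
      have b: "block_index bs u < length ks" using block_index(1)[OF alternating that] len by simp
      then show ?thesis using block_index(2)[OF alternating that] unfolding nth[OF b] F_def by simp
    qed
    have "(i, j) \<in> label_rel m n bs \<longleftrightarrow> block_index bs (Inl i) < block_index bs (Inr j)"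
      by (rule label_rel_iff(1)[OF alternating ij])
    also have "\<dots> \<longleftrightarrow> ?r (Inl i) < ?r (Inr j)" using mono idx[OF L(1)] idx[OF L(2)] by metis
    also have "\<dots> \<longleftrightarrow> (i, j) \<in> S" using less[OF L] by simp
    finally show ?thesis .
  qed
  moreover have "label_rel m n bs \<subseteq> {1..m} \<times> {1..n}" unfolding label_rel_def by auto
  ultimately have "label_rel m n bs = S" using ferrers_subset[OF S] by auto
  then show thesis using that alternating by blast
qed

section \<open>Dimension of cells\<close>

lemma sum_fun_apply: "(\<Sum>a\<in>A. f a) x = (\<Sum>a\<in>A. f a x)"
  by (induction A rule: infinite_finite_induct) auto

text \<open>A finite-dimensional space of functions has a basis dual to finitely many evaluations, hence
  it is closed in the product topology.\<close>

lemma span_coordinates: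
  fixes G :: "matrix set"
  assumes "finite G"
  shows "\<exists>T w. finite T \<and> (\<forall>t \<in> T. w t \<in> matrix.span G) \<and>
     (\<forall>t \<in> T. \<forall>t' \<in> T. w t t' = (if t = t' then 1 else 0)) \<and>
     (\<forall>M \<in> matrix.span G. \<forall>k. M k = (\<Sum>t \<in> T. M t * w t k))"
  using assms
proof (induction G rule: finite_induct)
  case empty
  show ?case by (intro exI[of _ "{}"]) (simp add: matrix.span_empty)
next
  case (insert h G)
  then obtain T w where T: "finite T" and w: "\<forall>t \<in> T. w t \<in> matrix.span G"
    and dual: "\<forall>t \<in> T. \<forall>t' \<in> T. w t t' = (if t = t' then 1 else 0)"
    and rep: "\<forall>M \<in> matrix.span G. \<forall>k. M k = (\<Sum>t \<in> T. M t * w t k)" by (elim exE conjE)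
  note dual = dual[rule_format] and rep = rep[rule_format]
  define z where "z = (\<Sum>t \<in> T. (\<lambda>k. h t * w t k))"
  have z: "z \<in> matrix.span G"
    unfolding z_def using w by (intro matrix.span_sum matrix.span_scale) blast
  have z_apply: "z k = (\<Sum>t \<in> T. h t * w t k)" for k unfolding z_def by (rule sum_fun_apply)
  have z_T: "z t = h t" if "t \<in> T" for t
  proof -
    have "z t = (\<Sum>t' \<in> T. if t' = t then h t else 0)"
      unfolding z_apply using that dual by (intro sum.cong) auto
    then show ?thesis using that T by simp
  qed
  have sub: "matrix.span G \<subseteq> matrix.span (insert h G)" by (intro matrix.span_mono) auto
  have h: "h \<in> matrix.span (insert h G)" by (intro matrix.span_base) auto
  define v where "v = h - z"
  have v: "v \<in> matrix.span (insert h G)" unfolding v_def using h z sub by (intro matrix.span_diff) auto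
  show ?case
  proof (cases "v = 0")
    case True
    then have "h \<in> matrix.span G" using z unfolding v_def by simp
    then have "matrix.span (insert h G) = matrix.span G" by (rule matrix.span_redundant)
    then show ?thesis using insert.IH by simp
  next
    case False
    then obtain s where s: "v s \<noteq> 0" by (auto simp: fun_eq_iff)
    have v_T: "v t = 0" if "t \<in> T" for t using z_T[OF that] unfolding v_def by simp
    then have sT: "s \<notin> T" using s by blast
    define w' where "w' t = (if t = s then (\<lambda>k. (1 / v s) * v k)
       else w t - (\<lambda>k. (w t s / v s) * v k))" for t
    have w': "w' t \<in> matrix.span (insert h G)" if "t \<in> insert s T" for t
    proof (cases "t = s")
      case True
      then show ?thesis unfolding w'_def using matrix.span_scale[OF v, of "1 / v s"] by simp
    next
      case False
      then have "w t \<in> matrix.span (insert h G)" using w that sub by blast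
      then show ?thesis unfolding w'_def
        using False matrix.span_diff[OF _ matrix.span_scale[OF v, of "w t s / v s"]] by simp
    qed
    have dual': "w' t t' = (if t = t' then 1 else 0)" if "t \<in> insert s T" "t' \<in> insert s T" for t t'
      using that s sT v_T dual[of t t'] unfolding w'_def by (auto simp: v_T)
    have rep': "M k = (\<Sum>t \<in> insert s T. M t * w' t k)" if M: "M \<in> matrix.span (insert h G)" for M k
    proof -
      obtain c where c: "M - (\<lambda>k. c * h k) \<in> matrix.span G"
        using M unfolding matrix.span_insert by blast
      define u where "u = (M - (\<lambda>k. c * h k)) + (\<lambda>k. c * z k)"
      have u: "u \<in> matrix.span G"
        unfolding u_def by (intro matrix.span_add[OF c] matrix.span_scale z)
      have M_eq: "M k = u k + c * v k" for k
        unfolding u_def v_def by (simp add: algebra_simps)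
      have rep_M: "M k = (\<Sum>t \<in> T. M t * w t k) + c * v k" for k
        unfolding M_eq[of k] rep[OF u, of k] using M_eq v_T by simp
      have c_eq: "c = (M s - (\<Sum>t \<in> T. M t * w t s)) / v s"
        using rep_M[of s] s by (simp add: eq_divide_eq)
      have sum_eq: "(\<Sum>t \<in> insert s T. M t * w' t k) =
          M s / v s * v k + (\<Sum>t \<in> T. M t * w t k) - (\<Sum>t \<in> T. M t * w t s) / v s * v k"
      proof -
        have "(\<Sum>t \<in> T. M t * w' t k) = (\<Sum>t \<in> T. M t * w t k - M t * w t s / v s * v k)"
          using sT unfolding w'_def by (intro sum.cong) (auto simp: algebra_simps)
        also have "\<dots> = (\<Sum>t \<in> T. M t * w t k) - (\<Sum>t \<in> T. M t * w t s) / v s * v k"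
          by (simp add: sum_subtractf sum_distrib_right sum_divide_distrib)
        finally show ?thesis using T sT by (simp add: w'_def)
      qed
      have "M k = (\<Sum>t \<in> T. M t * w t k) + (M s - (\<Sum>t \<in> T. M t * w t s)) / v s * v k"
        using rep_M[of k] unfolding c_eq .
      then show ?thesis unfolding sum_eq by (simp only: diff_divide_distrib left_diff_distrib)
    qed
    show ?thesis
      by (intro exI[of _ "insert s T"] exI[of _ w']) (use T w' dual' rep' in blast)
  qed
qed

lemma closed_span:
  fixes G :: "matrix set"
  assumes "finite G"
  shows "closed (matrix.span G)"
proof -
  obtain T w where T: "finite T" "\<forall>t \<in> T. w t \<in> matrix.span G"
    and rep: "\<forall>M \<in> matrix.span G. \<forall>k. M k = (\<Sum>t \<in> T. M t * w t k)"
    using span_coordinates[OF assms] by blast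
  have "M \<in> matrix.span G" if "\<forall>k. M k = (\<Sum>t \<in> T. M t * w t k)" for M
  proof -
    have "M = (\<Sum>t \<in> T. (\<lambda>k. M t * w t k))" using that by (auto simp: fun_eq_iff sum_fun_apply)
    also have "\<dots> \<in> matrix.span G" using T by (intro matrix.span_sum matrix.span_scale) blast
    finally show ?thesis .
  qed
  then have "matrix.span G = {M. \<forall>k. M k = (\<Sum>t \<in> T. M t * w t k)}" using rep by blast
  also have "closed \<dots>"
    by (intro closed_Collect_all closed_Collect_eq continuous_intros
        continuous_on_product_then_coordinatewise)
  finally show ?thesis .
qed

lemma card_dual_le_dim:
  fixes w :: "nat \<times> nat \<Rightarrow> matrix"
  assumes T: "finite T" and w: "\<And>t. t \<in> T \<Longrightarrow> w t \<in> matrix.span V"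
    and dual: "\<And>t t'. t \<in> T \<Longrightarrow> t' \<in> T \<Longrightarrow> w t t' = (if t = t' then 1 else 0)"
    and V: "V \<subseteq> matrix.span G" "finite G"
  shows "card T \<le> matrix.dim V"
proof -
  have inj: "inj_on w T" using dual by (intro inj_onI) (metis zero_neq_one)
  have "matrix.independent (w ` T)"
  proof
    assume "matrix.dependent (w ` T)"
    then obtain u v where v: "v \<in> w ` T" "u v \<noteq> 0" and sum: "(\<Sum>v \<in> w ` T. (\<lambda>k. u v * v k)) = 0"
      using T by (auto simp: matrix.dependent_finite)
    then obtain t where t: "t \<in> T" "v = w t" by blast
    have "0 = (\<Sum>v \<in> w ` T. (\<lambda>k. u v * v k)) t" unfolding sum by simp
    also have "\<dots> = (\<Sum>t' \<in> T. u (w t') * w t' t)"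
      unfolding sum_fun_apply by (rule sum.reindex_cong[OF inj]) auto
    also have "\<dots> = (\<Sum>t' \<in> T. if t' = t then u (w t) else 0)" using dual t by (intro sum.cong) auto
    also have "\<dots> = u v" using T t by simp
    finally show False using v by simp
  qed
  obtain b where b: "b \<subseteq> V" "matrix.independent b" "V \<subseteq> matrix.span b" "card b = matrix.dim V"
    using matrix.basis_exists .
  have "finite b" using matrix.independent_span_bound[OF V(2) b(2)] b(1) V(1) by blast
  moreover have "matrix.span V \<subseteq> matrix.span b"
    using b(3) by (intro matrix.span_minimal matrix.subspace_span)
  then have "w ` T \<subseteq> matrix.span b" using w by blast
  ultimately have "card (w ` T) \<le> card b"
    using matrix.independent_span_bound \<open>matrix.independent (w ` T)\<close> by blast
  then show ?thesis using b(4) inj by (simp add: card_image)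
qed

text \<open>On a region, \<open>g\<close> is linear; the coefficient matrices of \<open>a i\<close> and \<open>b j\<close> are
  \<open>inc S (Inl i)\<close> and \<open>inc S (Inr j)\<close>, those of \<open>A i\<close> and \<open>B j\<close> are obtained from the complement
  of \<open>S\<close>.\<close>

definition inc :: "(nat \<times> nat) set \<Rightarrow> letter \<Rightarrow> matrix" where
  "inc E u = (\<lambda>(r, c). if (r, c) \<in> E \<and> (u = Inl r \<or> u = Inr c) then 1 else 0)"

lemma sum_inc:
  "finite I \<Longrightarrow> (\<Sum>i \<in> I. f i * inc E (Inl i) (r, c)) = (if (r, c) \<in> E \<and> r \<in> I then f r else 0)"
  "finite J \<Longrightarrow> (\<Sum>j \<in> J. f j * inc E (Inr j) (r, c)) = (if (r, c) \<in> E \<and> c \<in> J then f c else 0)"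
proof -
  have "(\<Sum>i \<in> I. f i * inc E (Inl i) (r, c)) = (\<Sum>i \<in> I. if i = r then (if (r, c) \<in> E then f r else 0) else 0)"
    by (intro sum.cong) (auto simp: inc_def)
  then show "(\<Sum>i \<in> I. f i * inc E (Inl i) (r, c)) = (if (r, c) \<in> E \<and> r \<in> I then f r else 0)"
    if "finite I" using that by simp
  have "(\<Sum>j \<in> J. f j * inc E (Inr j) (r, c)) = (\<Sum>j \<in> J. if j = c then (if (r, c) \<in> E then f c else 0) else 0)"
    by (intro sum.cong) (auto simp: inc_def)
  then show "(\<Sum>j \<in> J. f j * inc E (Inr j) (r, c)) = (if (r, c) \<in> E \<and> c \<in> J then f c else 0)"
    if "finite J" using that by simp
qed

lemma sum_inc_one:
  "finite I \<Longrightarrow> (\<Sum>i \<in> I. inc E (Inl i) (r, c)) = (if (r, c) \<in> E \<and> r \<in> I then 1 else 0)"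
  "finite J \<Longrightarrow> (\<Sum>j \<in> J. inc E (Inr j) (r, c)) = (if (r, c) \<in> E \<and> c \<in> J then 1 else 0)"
  using sum_inc[of _ "\<lambda>_. 1"] by simp_all

lemma inc_spanning:
  assumes fin: "finite I" "finite J" and E: "E \<subseteq> I \<times> J"
    and Z: "Z \<subseteq> I <+> J" "\<And>u. u \<in> Z \<Longrightarrow> inc E u = 0"
  shows "\<exists>B. finite B \<and> card B \<le> card I + card J - card Z - 1 \<and> inc E ` (I <+> J) \<subseteq> matrix.span B"
proof (cases "Z = I <+> J")
  case True
  then have "inc E ` (I <+> J) \<subseteq> matrix.span {}" using Z by (auto simp: matrix.span_zero)
  then show ?thesis by (intro exI[of _ "{}"]) simp
next
  case False
  then obtain u where u: "u \<in> I <+> J" "u \<notin> Z" using Z by blast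
  define B where "B = inc E ` ((I <+> J) - insert u Z)"
  have finL: "finite (I <+> J)" using fin by simp
  have "card B \<le> card ((I <+> J) - insert u Z)" unfolding B_def using finL by (intro card_image_le) simp
  also have "\<dots> = card (I <+> J) - card (insert u Z)"
    using u Z finL finite_subset[OF Z(1) finL] by (intro card_Diff_subset) auto
  also have "\<dots> = card I + card J - card Z - 1"
    using u finite_subset[OF Z(1) finL] fin by (simp add: card_Plus)
  finally have card: "card B \<le> card I + card J - card Z - 1" .
  have other: "inc E v \<in> matrix.span B" if "v \<in> I <+> J" "v \<noteq> u" for v
  proof (cases "v \<in> Z")
    case True
    then show ?thesis using Z by (simp add: matrix.span_zero)
  next
    case False
    then show ?thesis using that unfolding B_def by (intro matrix.span_base) auto
  qed
  have "inc E u \<in> matrix.span B"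
  proof (cases u)
    case (Inl i)
    then have i: "i \<in> I" using u by auto
    have "inc E u = (\<Sum>j \<in> J. inc E (Inr j)) - (\<Sum>i' \<in> I - {i}. inc E (Inl i'))"
    proof
      fix t :: "nat \<times> nat"
      show "inc E u t = ((\<Sum>j \<in> J. inc E (Inr j)) - (\<Sum>i' \<in> I - {i}. inc E (Inl i'))) t"
        using E fin unfolding Inl by (cases t) (simp add: sum_fun_apply sum_inc_one, auto simp: inc_def)
    qed
    also have "\<dots> \<in> matrix.span B"
      using Inl by (intro matrix.span_diff matrix.span_sum other) auto
    finally show ?thesis .
  next
    case (Inr j)
    have "inc E u = (\<Sum>i \<in> I. inc E (Inl i)) - (\<Sum>j' \<in> J - {j}. inc E (Inr j'))"
    proof
      fix t :: "nat \<times> nat"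
      show "inc E u t = ((\<Sum>i \<in> I. inc E (Inl i)) - (\<Sum>j' \<in> J - {j}. inc E (Inr j'))) t"
        using E fin unfolding Inr by (cases t) (simp add: sum_fun_apply sum_inc_one, auto simp: inc_def)
    qed
    also have "\<dots> \<in> matrix.span B"
      using Inr by (intro matrix.span_diff matrix.span_sum other) auto
    finally show ?thesis .
  qed
  then have "inc E ` (I <+> J) \<subseteq> matrix.span B" using other by blast
  moreover have "finite B" unfolding B_def using finL by simp
  ultimately show ?thesis using card by blast
qed

lemma g_region:
  assumes "(a, A, b, B) \<in> region m n S" "r \<in> {1..m}" "c \<in> {1..n}"
  shows "g m n (a, A, b, B) (r, c) = (if (r, c) \<in> S then a r + b c else A r + B c)"
proof -
  have "if (r, c) \<in> S then xcoord (a, A, b, B) r < ycoord (a, A, b, B) c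
      else xcoord (a, A, b, B) r > ycoord (a, A, b, B) c"
    using assms unfolding region_def by blast
  then show ?thesis using assms(2,3) by (auto simp: g_def xcoord_def ycoord_def split: if_splits)
qed

definition gens :: "nat \<Rightarrow> nat \<Rightarrow> (nat \<times> nat) set \<Rightarrow> matrix set" where
  "gens m n S = inc S ` ({1..m} <+> {1..n}) \<union> inc ({1..m} \<times> {1..n} - S) ` ({1..m} <+> {1..n})"

lemma finite_gens: "finite (gens m n S)"
  unfolding gens_def by simp

lemma g_in_span:
  assumes S: "S \<subseteq> {1..m} \<times> {1..n}" and p: "p \<in> region m n S"
  shows "g m n p \<in> matrix.span (gens m n S)"
proof -
  obtain a A b B where p_eq: "p = (a, A, b, B)" by (cases p)
  let ?I = "{1..m}" and ?J = "{1..n}"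
  let ?E = "?I \<times> ?J - S"
  have "g m n p = (\<Sum>i \<in> ?I. (\<lambda>k. a i * inc S (Inl i) k)) + (\<Sum>j \<in> ?J. (\<lambda>k. b j * inc S (Inr j) k))
     + (\<Sum>i \<in> ?I. (\<lambda>k. A i * inc ?E (Inl i) k)) + (\<Sum>j \<in> ?J. (\<lambda>k. B j * inc ?E (Inr j) k))"
    (is "_ = ?sum")
  proof
    fix t :: "nat \<times> nat"
    obtain r c where t: "t = (r, c)" by (cases t)
    show "g m n p t = ?sum t"
    proof (cases "(r, c) \<in> ?I \<times> ?J")
      case True
      then show ?thesis
        using p unfolding p_eq t by (simp add: g_region sum_fun_apply sum_inc)
    next
      case False
      then have "(r, c) \<notin> S" using S by blast
      moreover have "g m n p (r, c) = 0" using False unfolding p_eq g_def by auto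
      ultimately show ?thesis
        using False unfolding t by (auto simp: sum_fun_apply sum_inc)
    qed
  qed
  also have "\<dots> \<in> matrix.span (gens m n S)"
    by (intro matrix.span_add matrix.span_sum matrix.span_scale matrix.span_base)
      (auto simp: gens_def)
  finally show ?thesis .
qed

lemma cell_subset_span:
  assumes S: "S \<subseteq> {1..m} \<times> {1..n}"
  shows "cell m n (region m n S) \<subseteq> matrix.span (gens m n S)"
  unfolding cell_def using g_in_span[OF S]
  by (intro closure_minimal closed_span finite_gens) auto

lemma differences_subset_span:
  assumes S: "S \<subseteq> {1..m} \<times> {1..n}"
  shows "{M - N | M N. M \<in> cell m n (region m n S) \<and> N \<in> cell m n (region m n S)}
    \<subseteq> matrix.span (gens m n S)"
  using cell_subset_span[OF S] matrix.span_diff by blast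

lemma affine_dim_cell_le:
  assumes S: "S \<subseteq> {1..m} \<times> {1..n}"
    and Z1: "Z1 \<subseteq> {1..m} <+> {1..n}" "\<And>u. u \<in> Z1 \<Longrightarrow> inc S u = 0"
    and Z2: "Z2 \<subseteq> {1..m} <+> {1..n}" "\<And>u. u \<in> Z2 \<Longrightarrow> inc ({1..m} \<times> {1..n} - S) u = 0"
  shows "affine_dim (cell m n (region m n S)) \<le> (m + n - card Z1 - 1) + (m + n - card Z2 - 1)"
proof -
  obtain B1 where B1: "finite B1" "card B1 \<le> m + n - card Z1 - 1"
    "inc S ` ({1..m} <+> {1..n}) \<subseteq> matrix.span B1"
    using inc_spanning[OF _ _ S Z1] by auto
  obtain B2 where B2: "finite B2" "card B2 \<le> m + n - card Z2 - 1"
    "inc ({1..m} \<times> {1..n} - S) ` ({1..m} <+> {1..n}) \<subseteq> matrix.span B2"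
    using inc_spanning[OF _ _ _ Z2] by auto
  have "gens m n S \<subseteq> matrix.span (B1 \<union> B2)"
    using B1(3) B2(3) matrix.span_mono[of B1 "B1 \<union> B2"] matrix.span_mono[of B2 "B1 \<union> B2"]
    unfolding gens_def by blast
  then have "matrix.span (gens m n S) \<subseteq> matrix.span (B1 \<union> B2)"
    by (intro matrix.span_minimal matrix.subspace_span)
  then have "affine_dim (cell m n (region m n S)) \<le> card (B1 \<union> B2)"
    unfolding affine_dim_def
    using differences_subset_span[OF S] B1(1) B2(1) by (intro matrix.dim_le_card) auto
  also have "\<dots> \<le> card B1 + card B2" by (rule card_Un_le)
  finally show ?thesis using B1(2) B2(2) by linarith
qed

lemma near_rank_point:
  assumes S: "S \<in> ferrers {1..m} {1..n}" and p: "p \<in> points m n"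
    and x: "\<And>i. i \<in> {1..m} \<Longrightarrow> \<bar>xcoord p i - xcoord (rank_point m n S) i\<bar> \<le> 1"
    and y: "\<And>j. j \<in> {1..n} \<Longrightarrow> \<bar>ycoord p j - ycoord (rank_point m n S) j\<bar> \<le> 1"
  shows "p \<in> region m n S"
proof -
  have "if (i, j) \<in> S then xcoord p i < ycoord p j else xcoord p i > ycoord p j"
    if "i \<in> {1..m}" "j \<in> {1..n}" for i j
    using rank_point_gap[OF S that] x[OF that(1)] y[OF that(2)] by (auto split: if_splits)
  then show ?thesis using p unfolding region_def by blast
qed

lemma gens_subset_span_differences:
  assumes S: "S \<in> ferrers {1..m} {1..n}"
  shows "gens m n S \<subseteq>
    matrix.span {M - N | M N. M \<in> cell m n (region m n S) \<and> N \<in> cell m n (region m n S)}"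
    (is "_ \<subseteq> matrix.span ?V")
proof -
  let ?p = "rank_point m n S"
  obtain a A b B where p_eq: "?p = (a, A, b, B)" by (cases ?p)
  have pts: "(a, A, b, B) \<in> points m n"
    using rank_point_in_region[OF S] unfolding p_eq region_def by simp
  have p_reg: "(a, A, b, B) \<in> region m n S" using rank_point_in_region[OF S] unfolding p_eq .
  have diff: "M \<in> matrix.span ?V"
    if q: "q \<in> region m n S" and M: "M = g m n q - g m n (a, A, b, B)" for q M
  proof -
    have "g m n q \<in> cell m n (region m n S)" "g m n (a, A, b, B) \<in> cell m n (region m n S)"
      unfolding cell_def using q p_reg by (auto intro: subsetD[OF closure_subset])
    then have "M \<in> ?V" unfolding M by blast
    then show ?thesis by (rule matrix.span_base)
  qed
  have SI: "S \<subseteq> {1..m} \<times> {1..n}" using ferrers_subset[OF S] .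
  let ?E = "{1..m} \<times> {1..n} - S"
  have g_diff: "g m n (a', A', b', B') - g m n (a, A, b, B) = M"
    if q: "(a', A', b', B') \<in> region m n S"
      and M: "\<And>r c. r \<in> {1..m} \<Longrightarrow> c \<in> {1..n} \<Longrightarrow>
         M (r, c) = (if (r, c) \<in> S then a' r - a r + (b' c - b c) else A' r - A r + (B' c - B c))"
       "\<And>r c. (r, c) \<notin> {1..m} \<times> {1..n} \<Longrightarrow> M (r, c) = 0"
    for a' A' b' B' M
  proof
    fix t :: "nat \<times> nat"
    obtain r c where t: "t = (r, c)" by (cases t)
    show "(g m n (a', A', b', B') - g m n (a, A, b, B)) t = M t"
    proof (cases "(r, c) \<in> {1..m} \<times> {1..n}")
      case True
      then show ?thesis
        using g_region[OF q, of r c] g_region[OF p_reg, of r c] M(1) unfolding t by simp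
    next
      case False
      then show ?thesis using M(2) unfolding t g_def by auto
    qed
  qed
  note near = near_rank_point[OF S, unfolded p_eq]
  have "inc S (Inl i) \<in> matrix.span ?V" if i: "i \<in> {1..m}" for i
  proof -
    have q: "(a(i := a i + 1), A, b, B) \<in> region m n S"
      using pts i by (intro near) (auto simp: points_def vecs_def xcoord_def ycoord_def)
    show ?thesis
      by (rule diff[OF q], rule g_diff[OF q, symmetric]) (use SI in \<open>auto simp: inc_def\<close>)
  qed
  moreover have "inc ?E (Inl i) \<in> matrix.span ?V" if i: "i \<in> {1..m}" for i
  proof -
    have q: "(a, A(i := A i + 1), b, B) \<in> region m n S"
      using pts i by (intro near) (auto simp: points_def vecs_def xcoord_def ycoord_def)
    show ?thesis
      by (rule diff[OF q], rule g_diff[OF q, symmetric]) (use SI in \<open>auto simp: inc_def\<close>)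
  qed
  moreover have "inc S (Inr j) \<in> matrix.span ?V" if j: "j \<in> {1..n}" for j
  proof -
    have q: "(a, A, b(j := b j + 1), B) \<in> region m n S"
      using pts j by (intro near) (auto simp: points_def vecs_def xcoord_def ycoord_def)
    show ?thesis
      by (rule diff[OF q], rule g_diff[OF q, symmetric]) (use SI in \<open>auto simp: inc_def\<close>)
  qed
  moreover have "inc ?E (Inr j) \<in> matrix.span ?V" if j: "j \<in> {1..n}" for j
  proof -
    have q: "(a, A, b, B(j := B j + 1)) \<in> region m n S"
      using pts j by (intro near) (auto simp: points_def vecs_def xcoord_def ycoord_def)
    show ?thesis
      by (rule diff[OF q], rule g_diff[OF q, symmetric]) (use SI in \<open>auto simp: inc_def\<close>)
  qed
  ultimately show ?thesis unfolding gens_def by blast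
qed

text \<open>The first two letters of the label are \<open>i1\<close> and the negative \<open>j1\<close> (in either order), the
  last two are \<open>i2\<close> and \<open>j2\<close>, and each of the four is a block of its own.\<close>

definition small_rel ::
  "nat set \<Rightarrow> nat set \<Rightarrow> nat \<Rightarrow> nat \<Rightarrow> nat \<Rightarrow> nat \<Rightarrow> (nat \<times> nat) set \<Rightarrow> bool" where
  "small_rel I J i1 i2 j1 j2 S \<longleftrightarrow> S \<in> ferrers I J \<and>
     i1 \<in> I \<and> i2 \<in> I \<and> j1 \<in> J \<and> j2 \<in> J \<and> i1 \<noteq> i2 \<and> j1 \<noteq> j2 \<and>
     (\<forall>j \<in> J - {j1}. (i1, j) \<in> S) \<and> (\<forall>i \<in> I - {i1}. (i, j1) \<notin> S) \<and>
     (\<forall>j \<in> J - {j2}. (i2, j) \<notin> S) \<and> (\<forall>i \<in> I - {i2}. (i, j2) \<in> S) \<and>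
     (\<forall>i \<in> I - {i1}. row_less J S i1 i) \<and> (\<forall>i \<in> I - {i2}. row_less J S i i2) \<and>
     (\<forall>j \<in> J - {j1}. col_less I S j1 j) \<and> (\<forall>j \<in> J - {j2}. col_less I S j j2)"

lemma small_relD:
  assumes "small_rel I J i1 i2 j1 j2 S"
  shows "S \<in> ferrers I J" "i1 \<in> I" "i2 \<in> I" "j1 \<in> J" "j2 \<in> J" "i1 \<noteq> i2" "j1 \<noteq> j2"
    "\<And>j. j \<in> J \<Longrightarrow> j \<noteq> j1 \<Longrightarrow> (i1, j) \<in> S" "\<And>i. i \<noteq> i1 \<Longrightarrow> (i, j1) \<notin> S"
    "\<And>j. j \<noteq> j2 \<Longrightarrow> (i2, j) \<notin> S" "\<And>i. i \<in> I \<Longrightarrow> i \<noteq> i2 \<Longrightarrow> (i, j2) \<in> S"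
    "\<And>i. i \<in> I \<Longrightarrow> i \<noteq> i1 \<Longrightarrow> row_less J S i1 i" "\<And>i. i \<in> I \<Longrightarrow> i \<noteq> i2 \<Longrightarrow> row_less J S i i2"
    "\<And>j. j \<in> J \<Longrightarrow> j \<noteq> j1 \<Longrightarrow> col_less I S j1 j" "\<And>j. j \<in> J \<Longrightarrow> j \<noteq> j2 \<Longrightarrow> col_less I S j j2"
proof -
  have "S \<subseteq> I \<times> J" using assms ferrers_subset unfolding small_rel_def by blast
  then show "\<And>i. i \<noteq> i1 \<Longrightarrow> (i, j1) \<notin> S" "\<And>j. j \<noteq> j2 \<Longrightarrow> (i2, j) \<notin> S"
    using assms unfolding small_rel_def by auto
qed (use assms in \<open>simp_all add: small_rel_def\<close>)

lemma small_rel_dual_vectors: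
  assumes small: "small_rel I J i1 i2 j1 j2 S" and fin: "finite I" "finite J"
    and t: "t \<in> I \<times> J - (I - {i1, i2}) \<times> (J - {j1, j2})" (is "t \<in> ?T")
  shows "\<exists>M \<in> matrix.span (inc S ` (I <+> J) \<union> inc (I \<times> J - S) ` (I <+> J)).
     \<forall>t' \<in> ?T. M t' = (if t = t' then 1 else 0)"
proof -
  let ?E = "I \<times> J - S" and ?J = "J - {j1, j2}"
  let ?W = "matrix.span (inc S ` (I <+> J) \<union> inc ?E ` (I <+> J))"
  note D = small_relD[OF small]
  have W: "u \<in> I <+> J \<Longrightarrow> inc S u \<in> ?W" "u \<in> I <+> J \<Longrightarrow> inc ?E u \<in> ?W" for u
    by (auto intro!: matrix.span_base)
  define C1 where "C1 = inc ?E (Inl i1) + inc S (Inr j1)"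
  define C2 where "C2 = inc S (Inl i2) + inc ?E (Inr j2)"
  have C: "C1 \<in> ?W" "C2 \<in> ?W"
    unfolding C1_def C2_def using D by (auto intro!: matrix.span_add W)
  have C1: "C1 (r, c) = (if r = i1 \<and> c = j1 then 1 else 0)" if "r \<in> I" "c \<in> J" for r c
    using that D(1-10) unfolding C1_def by (auto simp: inc_def)
  have C2: "C2 (r, c) = (if r = i2 \<and> c = j2 then 1 else 0)" if "r \<in> I" "c \<in> J" for r c
    using that D(2-7,10,11) unfolding C2_def by (cases "c = j2") (auto simp: inc_def)
  define M1 where "M1 = inc S (Inl i1) + inc ?E (Inl i1) - C1 - (\<Sum>j \<in> ?J. inc S (Inr j))"
  define M2 where "M2 = inc S (Inl i2) + inc ?E (Inl i2) - C2 - (\<Sum>j \<in> ?J. inc ?E (Inr j))"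
  have M: "M1 \<in> ?W" "M2 \<in> ?W"
    unfolding M1_def M2_def using D by (auto intro!: matrix.span_add matrix.span_diff matrix.span_sum W C)
  obtain r c where rc: "t = (r, c)" by (cases t)
  have rcT: "r \<in> I" "c \<in> J" "r = i1 \<or> r = i2 \<or> c = j1 \<or> c = j2" using t rc by auto
  have dualI: ?thesis if "M \<in> ?W"
    and M: "\<And>r' c'. (r', c') \<in> ?T \<Longrightarrow> M (r', c') = (if r' = r \<and> c' = c then 1 else 0)" for M
  proof (rule bexI[OF _ that(1)], rule ballI)
    fix t' assume "t' \<in> ?T"
    then show "M t' = (if t = t' then 1 else 0)" using M unfolding rc by (cases t') auto
  qed
  note D' = D(1-11)
  from rcT(3) consider "r = i1" "c = j1" | "r = i1" "c = j2" | "r = i1" "c \<noteq> j1" "c \<noteq> j2"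
    | "r = i2" "c = j1" | "r = i2" "c = j2" | "r = i2" "c \<noteq> j1" "c \<noteq> j2"
    | "r \<noteq> i1" "r \<noteq> i2" "c = j1" | "r \<noteq> i1" "r \<noteq> i2" "c = j2" by blast
  then show ?thesis
  proof cases
    case 1
    show ?thesis using 1 C1 by (intro dualI[OF C(1)]) auto
  next
    case 2
    show ?thesis
      using 2 D' fin unfolding M1_def
      by (intro dualI[OF M(1), unfolded M1_def]) (simp add: sum_fun_apply sum_inc_one C1, auto simp: inc_def)
  next
    case 3
    then have "inc S (Inr c) \<in> ?W" using rcT by (intro W) auto
    then show ?thesis using D' 3 rcT by (intro dualI) (auto simp: inc_def)
  next
    case 4
    show ?thesis
      using 4 D' fin unfolding M2_def
      by (intro dualI[OF M(2), unfolded M2_def]) (simp add: sum_fun_apply sum_inc_one C2, auto simp: inc_def)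
  next
    case 5
    show ?thesis using 5 C2 by (intro dualI[OF C(2)]) auto
  next
    case 6
    then have "inc ?E (Inr c) \<in> ?W" using rcT by (intro W) auto
    then show ?thesis using D' 6 rcT by (intro dualI) (auto simp: inc_def)
  next
    case 7
    then have "inc ?E (Inl r) \<in> ?W" using rcT by (intro W) auto
    then show ?thesis using D' 7 rcT by (intro dualI) (auto simp: inc_def)
  next
    case 8
    then have "inc S (Inl r) \<in> ?W" using rcT by (intro W) auto
    then show ?thesis using D' 8 rcT by (intro dualI) (auto simp: inc_def)
  qed
qed

lemma affine_dim_small_ge:
  assumes small: "small_rel {1..m} {1..n} i1 i2 j1 j2 S"
  shows "2 * m + 2 * n - 4 \<le> affine_dim (cell m n (region m n S))"
proof -
  note D = small_relD[OF small]
  let ?V = "{M - N | M N. M \<in> cell m n (region m n S) \<and> N \<in> cell m n (region m n S)}"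
  let ?I = "{1..m} - {i1, i2}" and ?J = "{1..n} - {j1, j2}"
  define T where "T = {1..m} \<times> {1..n} - ?I \<times> ?J"
  have finT: "finite T" unfolding T_def by simp
  have card2: "card ?I = m - 2" "card ?J = n - 2" "2 \<le> m" "2 \<le> n"
    using D(2-7) card_mono[of "{1..m}" "{i1, i2}"] card_mono[of "{1..n}" "{j1, j2}"]
    by (auto simp: card_Diff_subset)
  have "card T = m * n - (m - 2) * (n - 2)"
    unfolding T_def by (subst card_Diff_subset) (auto simp: card2 card_cartesian_product simp del: One_nat_def)
  also have "\<dots> = 2 * m + 2 * n - 4"
  proof -
    obtain m' n' where "m = m' + 2" "n = n' + 2" using card2(3,4) by (metis le_add_diff_inverse2)
    then show ?thesis by (simp add: algebra_simps)
  qed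
  finally have cardT: "card T = 2 * m + 2 * n - 4" .
  have "matrix.span (gens m n S) \<subseteq> matrix.span ?V"
    using gens_subset_span_differences[OF D(1)] by (intro matrix.span_minimal matrix.subspace_span)
  moreover have "\<forall>t \<in> T. \<exists>M \<in> matrix.span (gens m n S). \<forall>t' \<in> T. M t' = (if t = t' then 1 else 0)"
    unfolding T_def gens_def
    by (intro ballI small_rel_dual_vectors[OF small finite_atLeastAtMost finite_atLeastAtMost])
  then obtain w where "\<forall>t \<in> T. w t \<in> matrix.span (gens m n S) \<and>
      (\<forall>t' \<in> T. w t t' = (if t = t' then 1 else 0))"
    by (subst (asm) Bex_def) metis
  ultimately have "card T \<le> matrix.dim ?V"
    using finT differences_subset_span[OF ferrers_subset[OF D(1)]] finite_gens
    by (intro card_dual_le_dim[of T w]) auto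
  then show ?thesis unfolding affine_dim_def cardT .
qed

section \<open>Labels of small cells\<close>

lemma affine_dim_label:
  assumes bs: "alternating_partition m n bs" and mn: "m \<ge> 2" "n \<ge> 2"
  defines "S \<equiv> label_rel m n bs"
  shows "affine_dim (cell m n (region m n S)) \<le> 2 * m + 2 * n - 4"
    and "affine_dim (cell m n (region m n S)) = 2 * m + 2 * n - 4 \<Longrightarrow>
      is_singleton (bs ! 0) \<and> is_singleton (bs ! (length bs - 1))"
    and "length bs \<ge> 2"
proof -
  let ?L = "{1..m} <+> {1..n}" and ?last = "length bs - 1"
  let ?k = "block_index bs"
  have one: "Inl 1 \<in> ?L" "Inr 1 \<in> ?L" using mn by auto
  have "?k (Inl 1) \<noteq> ?k (Inr 1)" using block_index_Inl_Inr[OF bs] mn by simp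
  then show len: "length bs \<ge> 2"
    using block_index(1)[OF bs one(1)] block_index(1)[OF bs one(2)] by linarith
  then have ends: "0 < length bs" "?last < length bs" "?last \<noteq> 0" by auto
  have first: "u \<in> ?L \<and> ?k u = 0" if "u \<in> bs ! 0" for u
    using block_index_unique[OF bs ends(1) that] by simp
  have last: "u \<in> ?L \<and> ?k u = ?last" if "u \<in> bs ! ?last" for u
    using block_index_unique[OF bs ends(2) that] by simp
  have fin: "finite (bs ! 0)" "finite (bs ! ?last)"
    using first last by (auto intro: finite_subset[of _ ?L])
  have ne: "card (bs ! 0) \<noteq> 0" "card (bs ! ?last) \<noteq> 0"
    using fin block_nonempty[OF bs ends(1)] block_nonempty[OF bs ends(2)] by (auto simp: card_eq_0_iff)
  define Z1 where "Z1 = bs ! ?last \<inter> range Inl \<union> bs ! 0 \<inter> range Inr"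
  define Z2 where "Z2 = bs ! 0 \<inter> range Inl \<union> bs ! ?last \<inter> range Inr"
  have Z_sub: "Z1 \<subseteq> ?L" "Z2 \<subseteq> ?L" unfolding Z1_def Z2_def using first last by auto
  have S: "S \<subseteq> {1..m} \<times> {1..n}" using ferrers_subset[OF label_rel_ferrers[OF bs]] unfolding S_def .
  have less: "?k (Inl i) < ?k (Inr j)" if "(i, j) \<in> S" for i j
    using label_rel_iff(1)[OF bs, of i j] S that unfolding S_def by auto
  have greater: "?k (Inr j) < ?k (Inl i)" if "i \<in> {1..m}" "j \<in> {1..n}" "(i, j) \<notin> S" for i j
    using label_rel_iff(2)[OF bs that(1,2)] that(3) unfolding S_def by simp
  have bound: "?k u \<le> ?last" if "u \<in> ?L" for u using block_index(1)[OF bs that] by linarith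
  have Z1: "inc S u = 0" if "u \<in> Z1" for u
  proof (rule ext)
    fix t :: "nat \<times> nat"
    obtain r c where t: "t = (r, c)" by (cases t)
    have "\<not> (u = Inl r \<or> u = Inr c)" if rc: "(r, c) \<in> S"
    proof -
      have "Inl r \<in> ?L" "Inr c \<in> ?L" using rc S by auto
      then show ?thesis using \<open>u \<in> Z1\<close> less[OF rc] bound[of "Inr c"] first last unfolding Z1_def by fastforce
    qed
    then show "inc S u t = 0 t" unfolding t inc_def by auto
  qed
  have Z2: "inc ({1..m} \<times> {1..n} - S) u = 0" if "u \<in> Z2" for u
  proof (rule ext)
    fix t :: "nat \<times> nat"
    obtain r c where t: "t = (r, c)" by (cases t)
    have "\<not> (u = Inl r \<or> u = Inr c)" if rc: "(r, c) \<in> {1..m} \<times> {1..n} - S"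
    proof -
      have "Inl r \<in> ?L" "Inr c \<in> ?L" using rc by auto
      moreover have "?k (Inr c) < ?k (Inl r)" using rc greater by auto
      ultimately show ?thesis using \<open>u \<in> Z2\<close> bound[of "Inl r"] first last unfolding Z2_def by fastforce
    qed
    then show "inc ({1..m} \<times> {1..n} - S) u t = 0 t" unfolding t inc_def by auto
  qed
  have split: "card X = card (X \<inter> range Inl) + card (X \<inter> range Inr)" if "finite X" for X :: "letter set"
  proof -
    have "x \<in> range Inl \<or> x \<in> range Inr" for x :: letter by (cases x) auto
    then have "X = (X \<inter> range Inl) \<union> (X \<inter> range Inr)" by blast
    then show ?thesis using that card_Un_disjoint[of "X \<inter> range Inl" "X \<inter> range Inr"] by auto
  qed
  have "card Z1 = card (bs ! ?last \<inter> range Inl) + card (bs ! 0 \<inter> range Inr)"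
    unfolding Z1_def using fin by (intro card_Un_disjoint) auto
  moreover have "card Z2 = card (bs ! 0 \<inter> range Inl) + card (bs ! ?last \<inter> range Inr)"
    unfolding Z2_def using fin by (intro card_Un_disjoint) auto
  ultimately have card_Z: "card Z1 + card Z2 = card (bs ! 0) + card (bs ! ?last)"
    using split[OF fin(1)] split[OF fin(2)] by linarith
  note dim = affine_dim_cell_le[OF S Z_sub(1) Z1 Z_sub(2) Z2]
  show "affine_dim (cell m n (region m n S)) \<le> 2 * m + 2 * n - 4"
    using dim card_Z ne mn by linarith
  show "is_singleton (bs ! 0) \<and> is_singleton (bs ! ?last)"
    if "affine_dim (cell m n (region m n S)) = 2 * m + 2 * n - 4"
  proof -
    have "card (bs ! 0) + card (bs ! ?last) \<le> 2" using dim card_Z ne mn that by linarith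
    then have "card (bs ! 0) = 1" "card (bs ! ?last) = 1" using ne by linarith+
    then show ?thesis by (simp add: is_singleton_altdef)
  qed
qed

lemma consecutive_singletons:
  assumes bs: "alternating_partition m n bs" and k: "Suc k < length bs"
    and single: "is_singleton (bs ! k)" "is_singleton (bs ! Suc k)"
  obtains i j where "i \<in> {1..m}" "j \<in> {1..n}"
    "block_index bs (Inl i) \<in> {k, Suc k}" "block_index bs (Inr j) \<in> {k, Suc k}"
    "\<And>u. u \<in> {1..m} <+> {1..n} \<Longrightarrow> block_index bs u \<in> {k, Suc k} \<Longrightarrow> u = Inl i \<or> u = Inr j"
proof -
  obtain u v where uv: "bs ! k = {u}" "bs ! Suc k = {v}" using single by (auto simp: is_singleton_def)
  have u: "u \<in> {1..m} <+> {1..n}" "block_index bs u = k"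
    using block_index_unique[OF bs Suc_lessD[OF k], of u] uv by auto
  have v: "v \<in> {1..m} <+> {1..n}" "block_index bs v = Suc k"
    using block_index_unique[OF bs k, of v] uv by auto
  have only: "w = u \<or> w = v" if "w \<in> {1..m} <+> {1..n}" "block_index bs w \<in> {k, Suc k}" for w
    using block_index(2)[OF bs that(1)] that(2) uv by auto
  have alt: "u \<in> range Inl \<longleftrightarrow> v \<in> range Inr" using alternating_next[OF bs k] unfolding uv by simp
  show thesis
  proof (cases u)
    case (Inl i)
    then obtain j where "v = Inr j" using alt by auto
    then show thesis using that[of i j] u v only Inl by auto
  next
    case (Inr j)
    then have "v \<notin> range Inr" using alt by auto
    then obtain i where "v = Inl i" by (cases v) auto
    then show thesis using that[of i j] u v only Inr by blast
  qed
qed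

lemma small_label_imp_small_rel:
  assumes bs: "alternating_partition m n bs" and mn: "m \<ge> 2" "n \<ge> 2"
    and dim: "affine_dim (cell m n (region m n (label_rel m n bs))) = 2 * m + 2 * n - 4"
    and single: "is_singleton (bs ! 1)" "is_singleton (bs ! (length bs - 2))"
  shows "\<exists>i1 i2 j1 j2. small_rel {1..m} {1..n} i1 i2 j1 j2 (label_rel m n bs)"
proof -
  let ?L = "{1..m} <+> {1..n}" and ?len = "length bs" and ?S = "label_rel m n bs"
  let ?k = "block_index bs"
  have len2: "?len \<ge> 2" using affine_dim_label(3)[OF bs mn] .
  have outer: "is_singleton (bs ! 0)" "is_singleton (bs ! (?len - 1))"
    using affine_dim_label(2)[OF bs mn dim] by auto
  have len: "?len \<ge> 4"
  proof (rule ccontr)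
    assume "\<not> ?thesis"
    then have le3: "?len \<le> 3" by simp
    have all: "is_singleton (bs ! k)" if "k < ?len" for k
    proof -
      have "k = 0 \<or> k = 1 \<or> k = ?len - 1" using that le3 by linarith
      then show ?thesis using outer single by blast
    qed
    have "inj_on ?k ?L"
    proof (rule inj_onI)
      fix u v assume uv: "u \<in> ?L" "v \<in> ?L" "?k u = ?k v"
      obtain w where "bs ! ?k u = {w}" using all[OF block_index(1)[OF bs uv(1)]] by (auto simp: is_singleton_def)
      then show "u = v" using block_index(2)[OF bs uv(1)] block_index(2)[OF bs uv(2)] uv(3) by auto
    qed
    moreover have "?k ` ?L \<subseteq> {..<?len}" using block_index(1)[OF bs] by auto
    ultimately have "card ?L \<le> card {..<?len}" by (intro card_inj_on_le) auto
    then show False using le3 mn by (simp add: card_Plus)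
  qed
  have k0: "Suc 0 < ?len" and kl: "Suc (?len - 2) < ?len" using len by auto
  have "is_singleton (bs ! Suc (?len - 2))" using outer(2) len by (simp add: Suc_diff_Suc numeral_2_eq_2)
  from consecutive_singletons[OF bs k0 outer(1)] single(1)
  obtain i1 j1 where 1: "i1 \<in> {1..m}" "j1 \<in> {1..n}" "?k (Inl i1) \<in> {0, Suc 0}" "?k (Inr j1) \<in> {0, Suc 0}"
    and only1: "\<And>u. u \<in> ?L \<Longrightarrow> ?k u \<in> {0, Suc 0} \<Longrightarrow> u = Inl i1 \<or> u = Inr j1" by auto
  from consecutive_singletons[OF bs kl single(2) \<open>is_singleton (bs ! Suc (?len - 2))\<close>]
  obtain i2 j2 where 2: "i2 \<in> {1..m}" "j2 \<in> {1..n}" "?k (Inl i2) \<in> {?len - 2, Suc (?len - 2)}"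
      "?k (Inr j2) \<in> {?len - 2, Suc (?len - 2)}"
    and only2: "\<And>u. u \<in> ?L \<Longrightarrow> ?k u \<in> {?len - 2, Suc (?len - 2)} \<Longrightarrow> u = Inl i2 \<or> u = Inr j2" by auto
  have low: "?k (Inl i1) \<le> 1" "?k (Inr j1) \<le> 1" using 1 by auto
  have high: "?len - 2 \<le> ?k (Inl i2)" "?len - 2 \<le> ?k (Inr j2)" using 2 by auto
  have above: "2 \<le> ?k u" if "u \<in> ?L" "u \<noteq> Inl i1" "u \<noteq> Inr j1" for u
  proof -
    have "?k u \<notin> {0, Suc 0}" using only1[OF that(1)] that(2,3) by blast
    then show ?thesis by auto
  qed
  have below: "?k u < ?len - 2" if "u \<in> ?L" "u \<noteq> Inl i2" "u \<noteq> Inr j2" for u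
  proof -
    have "?k u \<notin> {?len - 2, Suc (?len - 2)}" using only2[OF that(1)] that(2,3) by blast
    moreover have "?k u < ?len" using block_index(1)[OF bs that(1)] .
    ultimately show ?thesis by auto
  qed
  have above': "2 \<le> ?k (Inl i)" if "i \<in> {1..m}" "i \<noteq> i1" for i using above[OF InlI] that by simp
  have above'': "2 \<le> ?k (Inr j)" if "j \<in> {1..n}" "j \<noteq> j1" for j using above[OF InrI] that by simp
  have below': "?k (Inl i) < ?len - 2" if "i \<in> {1..m}" "i \<noteq> i2" for i using below[OF InlI] that by simp
  have below'': "?k (Inr j) < ?len - 2" if "j \<in> {1..n}" "j \<noteq> j2" for j using below[OF InrI] that by simp
  have "i1 \<noteq> i2" "j1 \<noteq> j2" using low high len by auto
  moreover have "(i1, j) \<in> ?S" if "j \<in> {1..n} - {j1}" for j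
    using that above''[of j] low unfolding label_rel_iff(1)[OF bs 1(1) DiffD1[OF that]] by auto
  moreover have "(i, j1) \<notin> ?S" if "i \<in> {1..m} - {i1}" for i
    using that above'[of i] low unfolding label_rel_iff(2)[OF bs DiffD1[OF that] 1(2)] by auto
  moreover have "(i2, j) \<notin> ?S" if "j \<in> {1..n} - {j2}" for j
    using that below''[of j] high unfolding label_rel_iff(2)[OF bs 2(1) DiffD1[OF that]] by auto
  moreover have "(i, j2) \<in> ?S" if "i \<in> {1..m} - {i2}" for i
    using that below'[of i] high unfolding label_rel_iff(1)[OF bs DiffD1[OF that] 2(2)] by auto
  moreover have "row_less {1..n} ?S i1 i" if "i \<in> {1..m} - {i1}" for i
    using that above'[of i] low by (intro block_between_Inl[OF bs 1(1)]) auto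
  moreover have "row_less {1..n} ?S i i2" if "i \<in> {1..m} - {i2}" for i
    using that below'[of i] high by (intro block_between_Inl[OF bs _ 2(1)]) auto
  moreover have "col_less {1..m} ?S j1 j" if "j \<in> {1..n} - {j1}" for j
    using that above''[of j] low by (intro block_between_Inr[OF bs 1(2)]) auto
  moreover have "col_less {1..m} ?S j j2" if "j \<in> {1..n} - {j2}" for j
    using that below''[of j] high by (intro block_between_Inr[OF bs _ 2(2)]) auto
  ultimately have "small_rel {1..m} {1..n} i1 i2 j1 j2 ?S"
    unfolding small_rel_def using label_rel_ferrers[OF bs] 1(1,2) 2(1,2)
    by (simp del: One_nat_def)
  then show ?thesis by blast
qed

lemma small_rel_imp_small_label:
  assumes bs: "alternating_partition m n bs"
    and small: "small_rel {1..m} {1..n} i1 i2 j1 j2 (label_rel m n bs)"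
  shows "is_singleton (bs ! 1)" "is_singleton (bs ! (length bs - 2))"
proof -
  let ?L = "{1..m} <+> {1..n}" and ?len = "length bs" and ?S = "label_rel m n bs"
  let ?k = "block_index bs"
  note D = small_relD[OF small]
  note iff = label_rel_iff[OF bs]
  have in_L: "Inl i1 \<in> ?L" "Inr j1 \<in> ?L" "Inl i2 \<in> ?L" "Inr j2 \<in> ?L" using D(2-5) by auto
  have neq: "?k (Inl i1) \<noteq> ?k (Inr j1)" "?k (Inl i2) \<noteq> ?k (Inr j2)"
    using block_index_Inl_Inr[OF bs] D(2-5) by auto
  have bound: "?k u < ?len" if "u \<in> ?L" for u using block_index(1)[OF bs that] .
  have len: "?len \<ge> 2" using neq(1) bound[OF in_L(1)] bound[OF in_L(2)] by linarith
  have row: "?k (Inl i) < ?k (Inl k)" if "row_less {1..n} ?S i k" "i \<in> {1..m}" "k \<in> {1..m}" for i k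
    using that iff unfolding row_less_def by (meson order.strict_trans)
  have col: "?k (Inr j) < ?k (Inr l)" if "col_less {1..m} ?S j l" "j \<in> {1..n}" "l \<in> {1..n}" for j l
    using that iff unfolding col_less_def by (meson order.strict_trans)
  have above: "?k (Inl i1) < ?k u \<and> ?k (Inr j1) < ?k u" if "u \<in> ?L" "u \<noteq> Inl i1" "u \<noteq> Inr j1" for u
  proof (cases u)
    case (Inl i)
    then have i: "i \<in> {1..m}" "i \<noteq> i1" using that by auto
    then show ?thesis using row[OF D(12)[OF i] D(2) i(1)] D(9)[OF i(2)] iff(2)[OF i(1) D(4)] Inl by simp
  next
    case (Inr j)
    then have j: "j \<in> {1..n}" "j \<noteq> j1" using that by auto
    then show ?thesis using col[OF D(14)[OF j] D(4) j(1)] D(8)[OF j] iff(1)[OF D(2) j(1)] Inr by simp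
  qed
  have below: "?k u < ?k (Inl i2) \<and> ?k u < ?k (Inr j2)" if "u \<in> ?L" "u \<noteq> Inl i2" "u \<noteq> Inr j2" for u
  proof (cases u)
    case (Inl i)
    then have i: "i \<in> {1..m}" "i \<noteq> i2" using that by auto
    then show ?thesis using row[OF D(13)[OF i] i(1) D(3)] D(11)[OF i] iff(1)[OF i(1) D(5)] Inl by simp
  next
    case (Inr j)
    then have j: "j \<in> {1..n}" "j \<noteq> j2" using that by auto
    then show ?thesis using col[OF D(15)[OF j] j(1) D(5)] D(10)[OF j(2)] iff(2)[OF D(3) j(1)] Inr by simp
  qed
  have single: "is_singleton (bs ! k)"
    if k: "k < ?len" and l: "l < ?len" "l \<noteq> k"
      and kl: "\<And>u. u \<in> ?L \<Longrightarrow> ?k u = k \<or> ?k u = l \<Longrightarrow> u \<in> {v, w}" for k l v w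
  proof -
    obtain x y where x: "x \<in> bs ! k" and y: "y \<in> bs ! l"
      using block_nonempty[OF bs k] block_nonempty[OF bs l(1)] by metis
    have y': "y \<in> {v, w}" "?k y = l" using kl block_index_unique[OF bs l(1) y] by auto
    have "z = x" if "z \<in> bs ! k" for z
    proof -
      have "z \<in> {v, w}" "?k z = k" "x \<in> {v, w}" "?k x = k"
        using kl block_index_unique[OF bs k that] block_index_unique[OF bs k x] by auto
      then show ?thesis using y' l(2) by auto
    qed
    then show ?thesis using x by (intro is_singletonI') auto
  qed
  show "is_singleton (bs ! 1)"
  proof (rule single[of 1 0 "Inl i1" "Inr j1"])
    fix u assume u: "u \<in> ?L" "?k u = 1 \<or> ?k u = 0"
    show "u \<in> {Inl i1, Inr j1}"
    proof (rule ccontr)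
      assume "u \<notin> {Inl i1, Inr j1}"
      then have "?k (Inl i1) < ?k u" "?k (Inr j1) < ?k u" using above[OF u(1)] by auto
      then show False using u(2) neq(1) by linarith
    qed
  qed (use len in auto)
  show "is_singleton (bs ! (?len - 2))"
  proof (rule single[of "?len - 2" "?len - 1" "Inl i2" "Inr j2"])
    fix u assume u: "u \<in> ?L" "?k u = ?len - 2 \<or> ?k u = ?len - 1"
    show "u \<in> {Inl i2, Inr j2}"
    proof (rule ccontr)
      assume "u \<notin> {Inl i2, Inr j2}"
      then have "?k u < ?k (Inl i2)" "?k u < ?k (Inr j2)" using below[OF u(1)] by auto
      then show False using u(2) neq(2) bound[OF in_L(3)] bound[OF in_L(4)] by linarith
    qed
  qed (use len in auto)
qed

lemma small_cells_eq:
  assumes mn: "m \<ge> 2" "n \<ge> 2"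
  shows "small_cells m n =
    {cell m n (region m n S) | S i1 i2 j1 j2. small_rel {1..m} {1..n} i1 i2 j1 j2 S}"
proof (intro set_eqI iffI)
  fix C assume "C \<in> small_cells m n"
  then obtain R bs where C: "C = cell m n R" and lab: "label_blocks m n R bs"
    and dim: "affine_dim (cell m n R) = 2 * m + 2 * n - 4"
    and single: "is_singleton (bs ! 1)" "is_singleton (bs ! (length bs - 2))"
    unfolding small_cells_def by blast
  have bs: "alternating_partition m n bs" and R: "R = region m n (label_rel m n bs)"
    using lab unfolding label_blocks_iff by auto
  show "C \<in> {cell m n (region m n S) | S i1 i2 j1 j2. small_rel {1..m} {1..n} i1 i2 j1 j2 S}"
    using small_label_imp_small_rel[OF bs mn dim[unfolded R] single] unfolding C R by blast
next
  fix C assume "C \<in> {cell m n (region m n S) | S i1 i2 j1 j2. small_rel {1..m} {1..n} i1 i2 j1 j2 S}"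
  then obtain S i1 i2 j1 j2 where C: "C = cell m n (region m n S)"
    and small: "small_rel {1..m} {1..n} i1 i2 j1 j2 S" by blast
  have S: "S \<in> ferrers {1..m} {1..n}" using small_relD(1)[OF small] .
  obtain bs where bs: "alternating_partition m n bs" and lab: "label_rel m n bs = S"
    using label_exists[OF S] .
  have "region m n S \<in> regions m n" unfolding regions_eq using S by blast
  moreover have "label_blocks m n (region m n S) bs" unfolding label_blocks_iff lab using bs by simp
  moreover have "affine_dim (cell m n (region m n S)) = 2 * m + 2 * n - 4"
    using affine_dim_small_ge[OF small] affine_dim_label(1)[OF bs mn] unfolding lab by simp
  moreover have "is_singleton (bs ! 1)" "is_singleton (bs ! (length bs - 2))"
    using small_rel_imp_small_label[OF bs] small lab by auto
  ultimately show "C \<in> small_cells m n" unfolding small_cells_def C by blast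
qed

section \<open>Minors\<close>

definition minor :: "nat \<Rightarrow> nat \<Rightarrow> nat \<Rightarrow> nat \<Rightarrow> matrix \<Rightarrow> real" where
  "minor i k j l M = M (i, j) + M (k, l) - M (i, l) - M (k, j)"

text \<open>The intervals \<open>[x\<^sub>i, x\<^sub>k]\<close> and \<open>[y\<^sub>j, y\<^sub>l]\<close> overlap at every point of the region.\<close>

definition overlap :: "nat set \<Rightarrow> nat set \<Rightarrow> (nat \<times> nat) set \<Rightarrow> nat \<Rightarrow> nat \<Rightarrow> nat \<Rightarrow> nat \<Rightarrow> bool" where
  "overlap I J S i k j l \<longleftrightarrow> row_less J S i k \<and> col_less I S j l \<and> (i, l) \<in> S \<and> (k, j) \<notin> S"

definition pos_minor :: "matrix set \<Rightarrow> nat \<Rightarrow> nat \<Rightarrow> nat \<Rightarrow> nat \<Rightarrow> bool" where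
  "pos_minor C i k j l \<longleftrightarrow> (\<forall>M \<in> C. 0 \<le> minor i k j l M) \<and> (\<exists>M \<in> C. 0 < minor i k j l M)"

lemma minor_flip: "minor k i l j M = minor i k j l M"
  by (simp add: minor_def)

lemma continuous_on_minor: "continuous_on T (minor i k j l)"
  unfolding minor_def by (intro continuous_intros continuous_on_product_then_coordinatewise)

lemma minor_g:
  assumes "i \<in> {1..m}" "k \<in> {1..m}" "j \<in> {1..n}" "l \<in> {1..n}"
  shows "minor i k j l (g m n p) = min (xcoord p i) (ycoord p j) + min (xcoord p k) (ycoord p l)
    - min (xcoord p i) (ycoord p l) - min (xcoord p k) (ycoord p j)"
proof -
  obtain a A b B where p: "p = (a, A, b, B)" by (cases p)
  have "g m n p (r, c) = A r + b c + min (xcoord p r) (ycoord p c)" if "r \<in> {1..m}" "c \<in> {1..n}" for r c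
    using that by (simp add: p g_def xcoord_def ycoord_def min_def)
  then show ?thesis using assms by (simp add: minor_def)
qed

lemma in_region_iff:
  assumes "p \<in> region m n S" "i \<in> {1..m}" "j \<in> {1..n}"
  shows "(i, j) \<in> S \<longleftrightarrow> xcoord p i < ycoord p j" "(i, j) \<notin> S \<longleftrightarrow> ycoord p j < xcoord p i"
proof -
  have "if (i, j) \<in> S then xcoord p i < ycoord p j else xcoord p i > ycoord p j"
    using assms unfolding region_def by blast
  then show "(i, j) \<in> S \<longleftrightarrow> xcoord p i < ycoord p j" "(i, j) \<notin> S \<longleftrightarrow> ycoord p j < xcoord p i"
    by (auto split: if_splits)
qed

lemma overlap_minor_pos:
  assumes ov: "overlap {1..m} {1..n} S i k j l" and p: "p \<in> region m n S"
    and ran: "i \<in> {1..m}" "k \<in> {1..m}" "j \<in> {1..n}" "l \<in> {1..n}"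
  shows "0 < minor i k j l (g m n p)"
proof -
  obtain j' where j': "j' \<in> {1..n}" "(i, j') \<in> S" "(k, j') \<notin> S"
    using ov unfolding overlap_def row_less_def by blast
  obtain i' where i': "i' \<in> {1..m}" "(i', j) \<notin> S" "(i', l) \<in> S"
    using ov unfolding overlap_def col_less_def by blast
  have "xcoord p i < xcoord p k"
    using in_region_iff(1)[OF p ran(1) j'(1)] in_region_iff(2)[OF p ran(2) j'(1)] j' by linarith
  moreover have "ycoord p j < ycoord p l"
    using in_region_iff(2)[OF p i'(1) ran(3)] in_region_iff(1)[OF p i'(1) ran(4)] i' by linarith
  moreover have "xcoord p i < ycoord p l" "ycoord p j < xcoord p k"
    using ov in_region_iff(1)[OF p ran(1,4)] in_region_iff(2)[OF p ran(2,3)]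
    unfolding overlap_def by auto
  ultimately show ?thesis unfolding minor_g[OF ran] by (auto simp: min_def)
qed

lemma overlap_imp_pos_minor:
  assumes S: "S \<in> ferrers {1..m} {1..n}" and ov: "overlap {1..m} {1..n} S i k j l"
    and ran: "i \<in> {1..m}" "k \<in> {1..m}" "j \<in> {1..n}" "l \<in> {1..n}"
  shows "pos_minor (cell m n (region m n S)) i k j l"
proof -
  have pos: "0 < minor i k j l (g m n p)" if "p \<in> region m n S" for p
    using overlap_minor_pos[OF ov that ran] .
  have "g m n (rank_point m n S) \<in> cell m n (region m n S)"
    unfolding cell_def using rank_point_in_region[OF S] by (auto intro: subsetD[OF closure_subset])
  moreover have "cell m n (region m n S) \<subseteq> {M. 0 \<le> minor i k j l M}"
    unfolding cell_def using pos
    by (intro closure_minimal closed_Collect_le continuous_on_const continuous_on_minor)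
      (auto intro: less_imp_le)
  ultimately show ?thesis
    unfolding pos_minor_def using pos[OF rank_point_in_region[OF S]] by blast
qed

lemma vecs_comp: "v \<in> vecs k \<Longrightarrow> (\<And>i. f i \<in> {1..k} \<longleftrightarrow> i \<in> {1..k}) \<Longrightarrow> v \<circ> f \<in> vecs k"
  by (simp add: vecs_def del: atLeastAtMost_iff)

text \<open>Rows (columns) that compare equally with all columns (rows) may be exchanged without
  leaving the region, and this changes the sign of the minor.\<close>

lemma nonneg_minor_imp_overlap:
  assumes S: "S \<in> ferrers {1..m} {1..n}" and p: "p \<in> region m n S"
    and nonneg: "\<And>q. q \<in> region m n S \<Longrightarrow> 0 \<le> minor i k j l (g m n q)"
    and ran: "i \<in> {1..m}" "k \<in> {1..m}" "j \<in> {1..n}" "l \<in> {1..n}"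
    and x: "xcoord p i < xcoord p k" and y: "ycoord p j < ycoord p l"
    and xy: "xcoord p i < ycoord p l" "ycoord p j < xcoord p k"
  shows "overlap {1..m} {1..n} S i k j l"
proof -
  obtain a A b B where p_eq: "p = (a, A, b, B)" by (cases p)
  note iff = in_region_iff[OF p]
  have contra: False
    if q: "q \<in> region m n S" "minor i k j l (g m n q) = - minor i k j l (g m n p)" for q
  proof -
    have "0 < minor i k j l (g m n p)" unfolding minor_g[OF ran] using x y xy by (auto simp: min_def)
    then show False using nonneg[OF q(1)] q(2) by simp
  qed
  have "row_less {1..n} S i k"
  proof (rule ccontr)
    assume not: "\<not> ?thesis"
    have eq: "(i, c) \<in> S \<longleftrightarrow> (k, c) \<in> S" if c: "c \<in> {1..n}" for c
      using not c iff(1)[OF ran(1) c] iff(1)[OF ran(2) c] x unfolding row_less_def by auto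
    define f where "f = (\<lambda>r. if r = i then k else if r = k then i else r)"
    define q where "q = (a \<circ> f, A \<circ> f, b, B)"
    have f: "f r \<in> {1..m} \<longleftrightarrow> r \<in> {1..m}" for r using ran unfolding f_def by auto
    have qx: "xcoord q r = xcoord p (f r)" "ycoord q c = ycoord p c" for r c
      by (simp_all add: q_def p_eq xcoord_def ycoord_def)
    have "q \<in> points m n"
      using p vecs_comp[OF _ f] unfolding region_def q_def p_eq points_def by auto
    moreover have "if (r, c) \<in> S then xcoord q r < ycoord q c else xcoord q r > ycoord q c"
      if "r \<in> {1..m}" "c \<in> {1..n}" for r c
    proof -
      have "(f r, c) \<in> S \<longleftrightarrow> (r, c) \<in> S" using eq[OF that(2)] unfolding f_def by auto
      then show ?thesis unfolding qx using iff[OF _ that(2), of "f r"] f[of r] that(1) by auto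
    qed
    ultimately have "q \<in> region m n S" unfolding region_def by blast
    moreover have "minor i k j l (g m n q) = - minor i k j l (g m n p)"
      unfolding minor_g[OF ran] qx f_def by simp
    ultimately show False by (rule contra)
  qed
  moreover have "col_less {1..m} S j l"
  proof (rule ccontr)
    assume not: "\<not> ?thesis"
    have eq: "(r, j) \<in> S \<longleftrightarrow> (r, l) \<in> S" if r: "r \<in> {1..m}" for r
      using not r iff(1)[OF r ran(3)] iff(1)[OF r ran(4)] y unfolding col_less_def by auto
    define f where "f = (\<lambda>c. if c = j then l else if c = l then j else c)"
    define q where "q = (a, A, b \<circ> f, B \<circ> f)"
    have f: "f c \<in> {1..n} \<longleftrightarrow> c \<in> {1..n}" for c using ran unfolding f_def by auto
    have qx: "xcoord q r = xcoord p r" "ycoord q c = ycoord p (f c)" for r c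
      by (simp_all add: q_def p_eq xcoord_def ycoord_def)
    have "q \<in> points m n"
      using p vecs_comp[OF _ f] unfolding region_def q_def p_eq points_def by auto
    moreover have "if (r, c) \<in> S then xcoord q r < ycoord q c else xcoord q r > ycoord q c"
      if "r \<in> {1..m}" "c \<in> {1..n}" for r c
    proof -
      have "(r, f c) \<in> S \<longleftrightarrow> (r, c) \<in> S" using eq[OF that(1)] unfolding f_def by auto
      then show ?thesis unfolding qx using iff[OF that(1), of "f c"] f[of c] that(2) by auto
    qed
    ultimately have "q \<in> region m n S" unfolding region_def by blast
    moreover have "minor i k j l (g m n q) = - minor i k j l (g m n p)"
      unfolding minor_g[OF ran] qx f_def by simp
    ultimately show False by (rule contra)
  qed
  moreover have "(i, l) \<in> S" "(k, j) \<notin> S" using iff(1)[OF ran(1,4)] iff(2)[OF ran(2,3)] xy by auto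
  ultimately show ?thesis unfolding overlap_def by blast
qed

lemma pos_minor_imp_overlap:
  assumes S: "S \<in> ferrers {1..m} {1..n}" and pos: "pos_minor (cell m n (region m n S)) i k j l"
    and ran: "i \<in> {1..m}" "k \<in> {1..m}" "j \<in> {1..n}" "l \<in> {1..n}"
  shows "overlap {1..m} {1..n} S i k j l \<or> overlap {1..m} {1..n} S k i l j"
proof -
  have nonneg: "0 \<le> minor i k j l (g m n q)" if "q \<in> region m n S" for q
  proof -
    have "g m n q \<in> cell m n (region m n S)"
      unfolding cell_def using that by (auto intro: subsetD[OF closure_subset])
    then show ?thesis using pos unfolding pos_minor_def by blast
  qed
  have "\<exists>p \<in> region m n S. 0 < minor i k j l (g m n p)"
  proof (rule ccontr)
    assume "\<not> ?thesis"
    then have "g m n ` region m n S \<subseteq> {M. minor i k j l M \<le> 0}" by (auto simp: not_less)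
    then have "cell m n (region m n S) \<subseteq> {M. minor i k j l M \<le> 0}"
      unfolding cell_def
      by (intro closure_minimal closed_Collect_le continuous_on_const continuous_on_minor)
    then show False using pos unfolding pos_minor_def by fastforce
  qed
  then obtain p where p: "p \<in> region m n S" and gt: "0 < minor i k j l (g m n p)" by blast
  have "xcoord p i < xcoord p k \<and> ycoord p j < ycoord p l \<and> xcoord p i < ycoord p l \<and> ycoord p j < xcoord p k
    \<or> xcoord p k < xcoord p i \<and> ycoord p l < ycoord p j \<and> xcoord p k < ycoord p j \<and> ycoord p l < xcoord p i"
    using gt unfolding minor_g[OF ran] min_def by (auto split: if_splits)
  then show ?thesis
    using nonneg_minor_imp_overlap[OF S p nonneg ran]
      nonneg_minor_imp_overlap[OF S p nonneg[folded minor_flip[of k i l j]] ran(2,1,4,3)] by blast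
qed

lemma row_less_asym: "S \<in> ferrers I J \<Longrightarrow> row_less J S i k \<Longrightarrow> \<not> row_less J S k i"
  using letter_less_asym[of S I J "Inl i" "Inl k"] by simp

lemma col_less_asym: "S \<in> ferrers I J \<Longrightarrow> col_less I S j l \<Longrightarrow> \<not> col_less I S l j"
  using letter_less_asym[of S I J "Inr j" "Inr l"] by simp

lemma ferrers_complement: "S \<in> ferrers I J \<Longrightarrow> I \<times> J - S \<in> ferrers I J"
  unfolding ferrers_def by blast

lemma less_complement:
  "i \<in> I \<Longrightarrow> k \<in> I \<Longrightarrow> row_less J (I \<times> J - S) i k \<longleftrightarrow> row_less J S k i"
  "j \<in> J \<Longrightarrow> l \<in> J \<Longrightarrow> col_less I (I \<times> J - S) j l \<longleftrightarrow> col_less I S l j"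
  unfolding row_less_def col_less_def by blast+

lemma overlap_complement:
  assumes "i \<in> I" "k \<in> I" "j \<in> J" "l \<in> J"
  shows "overlap I J (I \<times> J - S) i k j l \<longleftrightarrow> overlap I J S k i l j"
  using assms unfolding overlap_def less_complement(1)[OF assms(1,2)] less_complement(2)[OF assms(3,4)]
  by blast

lemma small_rel_complement:
  assumes "small_rel I J i1 i2 j1 j2 S"
  shows "small_rel I J i2 i1 j2 j1 (I \<times> J - S)"
  using assms ferrers_complement unfolding small_rel_def by (auto simp: less_complement)

lemma small_rel_overlap:
  assumes "small_rel I J i1 i2 j1 j2 S"
  shows "overlap I J S i1 i2 j1 j2"
  using small_relD[OF assms] unfolding overlap_def by metis

lemma small_rel_params_unique:
  assumes small: "small_rel I J i1 i2 j1 j2 S" "small_rel I J i1' i2' j1' j2' S'"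
    and fwd: "\<And>i k j l. i \<in> I \<Longrightarrow> k \<in> I \<Longrightarrow> j \<in> J \<Longrightarrow> l \<in> J \<Longrightarrow>
      overlap I J S i k j l \<Longrightarrow> overlap I J S' i k j l \<or> overlap I J S' k i l j"
    and bwd: "\<And>i k j l. i \<in> I \<Longrightarrow> k \<in> I \<Longrightarrow> j \<in> J \<Longrightarrow> l \<in> J \<Longrightarrow>
      overlap I J S' i k j l \<Longrightarrow> overlap I J S i k j l \<or> overlap I J S k i l j"
    and orient: "overlap I J S' i1 i2 j1 j2"
  shows "i1' = i1 \<and> i2' = i2 \<and> j1' = j1 \<and> j2' = j2 \<and>
    S \<inter> (I - {i1, i2}) \<times> (J - {j1, j2}) = S' \<inter> (I - {i1, i2}) \<times> (J - {j1, j2})"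
proof -
  note D = small_relD[OF small(1)] and D' = small_relD[OF small(2)]
  note rasym = row_less_asym[OF D(1)] row_less_asym[OF D'(1)]
  note casym = col_less_asym[OF D(1)] col_less_asym[OF D'(1)]
  have rows: "row_less J S' i k" if ran: "i \<in> I" "k \<in> I" and less: "row_less J S i k" for i k
  proof -
    have "i \<noteq> i2" "k \<noteq> i1" using less rasym(1) D(12,13) ran by metis+
    then have "overlap I J S i k j1 j2"
      unfolding overlap_def using less ran D by metis
    then have "overlap I J S' i k j1 j2 \<or> overlap I J S' k i j2 j1" using fwd ran D(4,5) by blast
    then show ?thesis using orient casym(2) unfolding overlap_def by blast
  qed
  have cols: "col_less I S' j l" if ran: "j \<in> J" "l \<in> J" and less: "col_less I S j l" for j l
  proof -
    have "j \<noteq> j2" "l \<noteq> j1" using less casym(1) D(14,15) ran by metis+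
    then have "overlap I J S i1 i2 j l"
      unfolding overlap_def using less ran D by metis
    then have "overlap I J S' i1 i2 j l \<or> overlap I J S' i2 i1 l j" using fwd ran D(2,3) by blast
    then show ?thesis using orient rasym(2) unfolding overlap_def by blast
  qed
  have i: "i1' = i1" "i2' = i2"
    using rows rasym(2) D(2,3,12,13) D'(2,3,12,13) by metis+
  have j: "j1' = j1" "j2' = j2"
    using cols casym(2) D(4,5,14,15) D'(4,5,14,15) by metis+
  have "(r, c) \<in> S \<longleftrightarrow> (r, c) \<in> S'" if rc: "r \<in> I - {i1, i2}" "c \<in> J - {j1, j2}" for r c
  proof
    assume "(r, c) \<in> S"
    then have "overlap I J S r i2 j1 c" unfolding overlap_def using rc D by auto
    then have "overlap I J S' r i2 j1 c \<or> overlap I J S' i2 r c j1" using fwd rc D(3,4) by blast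
    moreover have "row_less J S' r i2" using rc D'(13) i by auto
    ultimately show "(r, c) \<in> S'" using rasym(2) unfolding overlap_def by blast
  next
    assume "(r, c) \<in> S'"
    then have "overlap I J S' r i2 j1 c" unfolding overlap_def using rc D' i j by auto
    then have "overlap I J S r i2 j1 c \<or> overlap I J S i2 r c j1" using bwd rc D(3,4) by blast
    moreover have "row_less J S r i2" using rc D(13) by auto
    ultimately show "(r, c) \<in> S" using rasym(1) unfolding overlap_def by blast
  qed
  then show ?thesis using i j by auto
qed

lemma small_cell_params_unique:
  assumes small: "small_rel {1..m} {1..n} i1 i2 j1 j2 S" "small_rel {1..m} {1..n} i1' i2' j1' j2' S'"
    and ord: "i1 < i2" "i1' < i2'"
    and eq: "cell m n (region m n S) = cell m n (region m n S')"
  shows "i1' = i1 \<and> i2' = i2 \<and> j1' = j1 \<and> j2' = j2 \<and>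
    S \<inter> ({1..m} - {i1, i2}) \<times> ({1..n} - {j1, j2}) = S' \<inter> ({1..m} - {i1, i2}) \<times> ({1..n} - {j1, j2})"
proof -
  let ?I = "{1..m}" and ?J = "{1..n}"
  note D = small_relD[OF small(1)] and D' = small_relD[OF small(2)]
  have fwd: "overlap ?I ?J S' i k j l \<or> overlap ?I ?J S' k i l j"
    if "i \<in> ?I" "k \<in> ?I" "j \<in> ?J" "l \<in> ?J" "overlap ?I ?J S i k j l" for i k j l
    using overlap_imp_pos_minor[OF D(1) that(5,1-4)] pos_minor_imp_overlap[OF D'(1) _ that(1-4)]
    unfolding eq by blast
  have bwd: "overlap ?I ?J S i k j l \<or> overlap ?I ?J S k i l j"
    if "i \<in> ?I" "k \<in> ?I" "j \<in> ?J" "l \<in> ?J" "overlap ?I ?J S' i k j l" for i k j l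
    using overlap_imp_pos_minor[OF D'(1) that(5,1-4)] pos_minor_imp_overlap[OF D(1) _ that(1-4)]
    unfolding eq by blast
  have "overlap ?I ?J S' i1 i2 j1 j2 \<or> overlap ?I ?J S' i2 i1 j2 j1"
    using fwd[OF D(2-5) small_rel_overlap[OF small(1)]] .
  then show ?thesis
  proof
    assume "overlap ?I ?J S' i1 i2 j1 j2"
    then show ?thesis by (intro small_rel_params_unique[OF small fwd bwd])
  next
    assume "overlap ?I ?J S' i2 i1 j2 j1"
    then have orient: "overlap ?I ?J (?I \<times> ?J - S') i1 i2 j1 j2"
      using overlap_complement[OF D(2-5)] by blast
    have "i2' = i1 \<and> i1' = i2 \<and> j2' = j1 \<and> j1' = j2 \<and>
      S \<inter> (?I - {i1, i2}) \<times> (?J - {j1, j2}) = (?I \<times> ?J - S') \<inter> (?I - {i1, i2}) \<times> (?J - {j1, j2})"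
    proof (rule small_rel_params_unique[OF small(1) small_rel_complement[OF small(2)] _ _ orient])
      fix i k j l assume ran: "i \<in> ?I" "k \<in> ?I" "j \<in> ?J" "l \<in> ?J"
      note comp = overlap_complement[OF ran, of S'] overlap_complement[OF ran(2,1,4,3), of S']
      show "overlap ?I ?J (?I \<times> ?J - S') i k j l \<or> overlap ?I ?J (?I \<times> ?J - S') k i l j"
        if "overlap ?I ?J S i k j l" using fwd[OF ran that] unfolding comp by blast
      show "overlap ?I ?J S i k j l \<or> overlap ?I ?J S k i l j"
        if "overlap ?I ?J (?I \<times> ?J - S') i k j l"
        using bwd[OF ran(2,1,4,3)] that unfolding comp by blast
    qed
    then show ?thesis using ord by simp
  qed
qed

text \<open>Exchanging \<open>(a, b)\<close> with \<open>(A, B)\<close> reverses the label and does not change \<open>g\<close>.\<close>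

lemma cell_complement:
  "cell m n (region m n ({1..m} \<times> {1..n} - S)) = cell m n (region m n S)"
proof -
  define flip :: "point \<Rightarrow> point" where "flip = (\<lambda>(a, A, b, B). (A, a, B, b))"
  have g_flip: "g m n (flip p) = g m n p" for p
    by (cases p) (auto simp: flip_def g_def fun_eq_iff min.commute)
  have xy: "xcoord (flip p) i = - xcoord p i" "ycoord (flip p) j = - ycoord p j" for p i j
    by (cases p; simp add: flip_def xcoord_def ycoord_def)+
  have pts: "flip p \<in> points m n \<longleftrightarrow> p \<in> points m n" for p
    by (cases p) (auto simp: flip_def points_def)
  have flip_region: "flip p \<in> region m n ({1..m} \<times> {1..n} - T)" if p: "p \<in> region m n T" for p T
  proof -
    have "flip p \<in> points m n" using p unfolding pts region_def by simp
    moreover have "if (i, j) \<in> {1..m} \<times> {1..n} - T then xcoord (flip p) i < ycoord (flip p) j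
        else xcoord (flip p) i > ycoord (flip p) j" if "i \<in> {1..m}" "j \<in> {1..n}" for i j
      using in_region_iff[OF p that] that unfolding xy by auto
    ultimately show ?thesis unfolding region_def by blast
  qed
  have sub: "g m n ` region m n T \<subseteq> g m n ` region m n ({1..m} \<times> {1..n} - T)" for T
    using flip_region g_flip by (metis image_eqI image_subsetI)
  have "region m n ({1..m} \<times> {1..n} - ({1..m} \<times> {1..n} - S)) = region m n S"
    unfolding region_def by auto
  then have "g m n ` region m n ({1..m} \<times> {1..n} - S) = g m n ` region m n S"
    using sub[of S] sub[of "{1..m} \<times> {1..n} - S"] by auto
  then show ?thesis unfolding cell_def by simp
qed

lemma g_region_two_by_two:
  assumes small: "small_rel {1..m} {1..n} i1 i2 j1 j2 S"
    and two: "{1..m} = {i1, i2}" "{1..n} = {j1, j2}"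
  shows "g m n ` region m n S =
    {M. (\<forall>t. t \<notin> {1..m} \<times> {1..n} \<longrightarrow> M t = 0) \<and> 0 < minor i1 i2 j1 j2 M}"
proof (intro set_eqI iffI)
  note D = small_relD[OF small]
  {
    fix M assume "M \<in> g m n ` region m n S"
    then obtain p where p: "p \<in> region m n S" "M = g m n p" by blast
    then have "0 < minor i1 i2 j1 j2 M"
      using overlap_minor_pos[OF small_rel_overlap[OF small] _ D(2-5)] by simp
    moreover have "M t = 0" if "t \<notin> {1..m} \<times> {1..n}" for t
      unfolding p(2) using that by (cases p; cases t) (auto simp: g_def)
    ultimately show "M \<in> {M. (\<forall>t. t \<notin> {1..m} \<times> {1..n} \<longrightarrow> M t = 0) \<and> 0 < minor i1 i2 j1 j2 M}" by blast
  }
  fix M :: matrix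
  assume "M \<in> {M. (\<forall>t. t \<notin> {1..m} \<times> {1..n} \<longrightarrow> M t = 0) \<and> 0 < minor i1 i2 j1 j2 M}"
  then have M: "\<And>t. t \<notin> {1..m} \<times> {1..n} \<Longrightarrow> M t = 0" "0 < minor i1 i2 j1 j2 M"
    unfolding mem_Collect_eq by blast+
  let ?p = "rank_point m n S"
  have p: "?p \<in> region m n S" using rank_point_in_region[OF D(1)] .
  have pos: "0 < minor i1 i2 j1 j2 (g m n ?p)"
    using overlap_minor_pos[OF small_rel_overlap[OF small] p D(2-5)] .
  define s where "s = minor i1 i2 j1 j2 M / minor i1 i2 j1 j2 (g m n ?p)"
  have s: "s > 0" unfolding s_def using M(2) pos by simp
  define x where "x i = s * xcoord ?p i" for i
  define y where "y j = s * ycoord ?p j" for j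
  define N where "N i j = M (i, j) - min (x i) (y j)" for i j
  have "minor i1 i2 j1 j2 M = s * minor i1 i2 j1 j2 (g m n ?p)" unfolding s_def using pos by simp
  also have "\<dots> = min (x i1) (y j1) + min (x i2) (y j2) - min (x i1) (y j2) - min (x i2) (y j1)"
    unfolding minor_g[OF D(2-5)] x_def y_def using s by (simp add: algebra_simps min_mult_distrib_left)
  finally have N: "N i1 j1 + N i2 j2 = N i1 j2 + N i2 j1" unfolding N_def minor_def by simp
  define u where "u i = N i j1" for i
  define v where "v j = N i1 j - N i1 j1" for j
  have uv: "M (i, j) = u i + v j + min (x i) (y j)" if "i \<in> {1..m}" "j \<in> {1..n}" for i j
    using that N unfolding two u_def v_def by (auto simp: N_def)
  define cut :: "nat \<Rightarrow> (nat \<Rightarrow> real) \<Rightarrow> nat \<Rightarrow> real" where "cut k f i = (if i \<in> {1..k} then f i else 0)" for k f i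
  define q where "q = (cut m (\<lambda>i. x i + u i), cut m u, cut n v, cut n (\<lambda>j. y j + v j))"
  have "q \<in> points m n" unfolding q_def points_def vecs_def cut_def by auto
  moreover have qxy: "i \<in> {1..m} \<Longrightarrow> xcoord q i = x i" "j \<in> {1..n} \<Longrightarrow> ycoord q j = y j" for i j
    unfolding q_def xcoord_def ycoord_def cut_def by auto
  moreover have "if (i, j) \<in> S then x i < y j else x i > y j" if "i \<in> {1..m}" "j \<in> {1..n}" for i j
    using in_region_iff[OF p that] s unfolding x_def y_def by simp
  ultimately have "q \<in> region m n S" unfolding region_def by simp
  moreover have "g m n q t = M t" for t
  proof (cases t)
    case (Pair i j)
    show ?thesis
    proof (cases "i \<in> {1..m} \<and> j \<in> {1..n}")
      case True
      then show ?thesis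
        using uv[of i j] unfolding Pair q_def g_def cut_def by (auto simp: min_def)
    next
      case False
      then have "M t = 0" using M(1) Pair by auto
      then show ?thesis using False unfolding Pair q_def g_def by auto
    qed
  qed
  ultimately show "M \<in> g m n ` region m n S" by (metis ext image_eqI)
qed

section \<open>Counting small cells\<close>

lemma small_rel_extension:
  assumes F: "F \<in> ferrers (I - {i1, i2}) (J - {j1, j2})"
    and ran: "i1 \<in> I" "i2 \<in> I" "j1 \<in> J" "j2 \<in> J" "i1 \<noteq> i2" "j1 \<noteq> j2"
  shows "\<exists>S. small_rel I J i1 i2 j1 j2 S \<and> S \<inter> (I - {i1, i2}) \<times> (J - {j1, j2}) = F"
proof -
  let ?I = "I - {i1, i2}" and ?J = "J - {j1, j2}"
  define e1 where "e1 \<longleftrightarrow> (\<exists>k \<in> ?I. \<forall>l \<in> ?J. (k, l) \<in> F)"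
  define e2 where "e2 \<longleftrightarrow> (\<exists>l \<in> ?J. \<forall>k \<in> ?I. (k, l) \<in> F)"
  define S where "S = {(r, c). r \<in> I \<and> c \<in> J \<and>
     (if r = i2 then c = j2 \<and> e2 else if c = j1 then r = i1 \<and> e1
      else r = i1 \<or> c = j2 \<or> (r, c) \<in> F)}"
  have mem: "(r, c) \<in> S \<longleftrightarrow> r \<in> I \<and> c \<in> J \<and>
     (if r = i2 then c = j2 \<and> e2 else if c = j1 then r = i1 \<and> e1
      else r = i1 \<or> c = j2 \<or> (r, c) \<in> F)" for r c
    unfolding S_def by simp
  have F_sub: "(r, c) \<in> F \<Longrightarrow> r \<in> ?I \<and> c \<in> ?J" for r c using ferrers_subset[OF F] by blast
  have "(k, j) \<in> S" if "(i, j) \<in> S" "(k, l) \<in> S" "(i, l) \<notin> S" for i j k l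
    using that ran ferrersD[OF F, of i j k l] unfolding mem by (auto split: if_splits)
  then have "S \<in> ferrers I J" unfolding ferrers_def S_def by blast
  moreover have "row_less J S i1 i" if i: "i \<in> I - {i1}" for i
  proof (cases "e1 \<and> i \<noteq> i2")
    case True
    then show ?thesis unfolding row_less_def using i ran by (intro bexI[of _ j1]) (auto simp: mem)
  next
    case False
    show ?thesis
    proof (cases "i = i2")
      case True
      show ?thesis
      proof (cases "?J = {}")
        case True
        then have "\<not> e2" unfolding e2_def by blast
        then show ?thesis unfolding row_less_def using \<open>i = i2\<close> ran by (intro bexI[of _ j2]) (auto simp: mem)
      next
        case False
        then obtain l where "l \<in> ?J" by blast
        then show ?thesis unfolding row_less_def using \<open>i = i2\<close> ran by (intro bexI[of _ l]) (auto simp: mem)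
      qed
    next
      case False
      then obtain l where "l \<in> ?J" "(i, l) \<notin> F" using \<open>\<not> (e1 \<and> i \<noteq> i2)\<close> i unfolding e1_def by blast
      then show ?thesis unfolding row_less_def using False i ran by (intro bexI[of _ l]) (auto simp: mem)
    qed
  qed
  moreover have "row_less J S i i2" if i: "i \<in> I - {i2}" for i
  proof (cases "i = i1")
    case True
    then show ?thesis using calculation(2)[of i2] ran by blast
  next
    case False
    show ?thesis
    proof (cases e2)
      case True
      then obtain l where "l \<in> ?J" "(i, l) \<in> F" using i False unfolding e2_def by blast
      then show ?thesis unfolding row_less_def using i ran by (intro bexI[of _ l]) (auto simp: mem)
    next
      case e2: False
      then show ?thesis unfolding row_less_def using i ran by (intro bexI[of _ j2]) (auto simp: mem)
    qed
  qed
  moreover have col_first: "col_less I S j1 j" if j: "j \<in> J - {j1}" for j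
  proof (cases e1)
    case False
    then show ?thesis unfolding col_less_def using j ran by (intro bexI[of _ i1]) (auto simp: mem)
  next
    case True
    then obtain k where "k \<in> ?I" "\<forall>l \<in> ?J. (k, l) \<in> F" unfolding e1_def by blast
    then show ?thesis unfolding col_less_def using j ran by (intro bexI[of _ k]) (auto simp: mem)
  qed
  moreover have "col_less I S j j2" if j: "j \<in> J - {j2}" for j
  proof (cases "j = j1")
    case True
    then show ?thesis using col_first[of j2] ran by blast
  next
    case j1: False
    show ?thesis
    proof (cases e2)
      case True
      then show ?thesis unfolding col_less_def using j ran by (intro bexI[of _ i2]) (auto simp: mem)
    next
      case False
      then obtain k where "k \<in> ?I" "(k, j) \<notin> F" using j j1 unfolding e2_def by blast
      then show ?thesis unfolding col_less_def using j j1 ran by (intro bexI[of _ k]) (auto simp: mem)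
    qed
  qed
  ultimately have "small_rel I J i1 i2 j1 j2 S"
    unfolding small_rel_def using ran by (auto simp: mem)
  moreover have "S \<inter> ?I \<times> ?J = F" using F_sub by (auto simp: mem)
  ultimately show ?thesis by blast
qed

text \<open>Unless \<open>I\<close> and \<open>J\<close> have two elements each, the sign of the third block tells
  which of the first two letters comes first.\<close>

lemma small_rel_corner:
  assumes small: "small_rel I J i1 i2 j1 j2 S" "small_rel I J i1 i2 j1 j2 T"
    and fin: "finite I" "finite J"
    and rest: "S \<inter> (I - {i1, i2}) \<times> (J - {j1, j2}) = T \<inter> (I - {i1, i2}) \<times> (J - {j1, j2})"
    and ne: "I - {i1, i2} \<noteq> {} \<or> J - {j1, j2} \<noteq> {}"
    and S: "(i1, j1) \<in> S"
  shows "(i1, j1) \<in> T"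
proof (rule ccontr)
  assume T: "(i1, j1) \<notin> T"
  let ?I = "I - {i1, i2}" and ?J = "J - {j1, j2}"
  note D = small_relD[OF small(1)] and D' = small_relD[OF small(2)]
  have eq: "(r, c) \<in> S \<longleftrightarrow> (r, c) \<in> T" if "r \<in> ?I" "c \<in> ?J" for r c using rest that by blast
  have col: "\<exists>k \<in> ?I. (k, l) \<in> S" if l: "l \<in> ?J" for l
  proof -
    obtain k where "k \<in> I" "(k, j1) \<notin> S" "(k, l) \<in> S" using D(14)[of l] l unfolding col_less_def by blast
    then show ?thesis using S D(10)[of l] l by (intro bexI[of _ k]) auto
  qed
  have row: "\<exists>l \<in> ?J. (k, l) \<notin> S" if k: "k \<in> ?I" for k
  proof -
    obtain l where l: "l \<in> J" "(i1, l) \<in> T" "(k, l) \<notin> T" using D'(12)[of k] k unfolding row_less_def by blast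
    then have "l \<in> ?J" using T D'(11)[of k] k by auto
    then show ?thesis using l eq k by blast
  qed
  have "?I \<noteq> {}" using ne col by blast
  then have "Max ((\<lambda>k. card {l \<in> J. (k, l) \<in> S}) ` ?I) \<in> (\<lambda>k. card {l \<in> J. (k, l) \<in> S}) ` ?I"
    using fin by (intro Max_in) auto
  then obtain k where k_Max: "Max ((\<lambda>k. card {l \<in> J. (k, l) \<in> S}) ` ?I) = card {l \<in> J. (k, l) \<in> S}"
    and k: "k \<in> ?I" by (rule imageE)
  have max: "card {l \<in> J. (k', l) \<in> S} \<le> card {l \<in> J. (k, l) \<in> S}" if "k' \<in> ?I" for k'
    unfolding k_Max[symmetric] using that fin by (intro Max_ge) auto
  obtain l where l: "l \<in> ?J" "(k, l) \<notin> S" using row[OF k] by blast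
  obtain k' where k': "k' \<in> ?I" "(k', l) \<in> S" using col[OF l(1)] by blast
  have "{c \<in> J. (k, c) \<in> S} \<subset> {c \<in> J. (k', c) \<in> S}"
    using ferrersD[OF D(1) _ k'(2) l(2)] k'(2) l by blast
  then have "card {c \<in> J. (k, c) \<in> S} < card {c \<in> J. (k', c) \<in> S}"
    using fin by (intro psubset_card_mono) auto
  then show False using max[OF k'(1)] by simp
qed

lemma small_rel_eqI:
  assumes small: "small_rel I J i1 i2 j1 j2 S" "small_rel I J i1 i2 j1 j2 T"
    and fin: "finite I" "finite J"
    and rest: "S \<inter> (I - {i1, i2}) \<times> (J - {j1, j2}) = T \<inter> (I - {i1, i2}) \<times> (J - {j1, j2})"
    and ne: "I - {i1, i2} \<noteq> {} \<or> J - {j1, j2} \<noteq> {}"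
  shows "S = T"
proof -
  note D = small_relD[OF small(1)] and D' = small_relD[OF small(2)]
  have sub: "S \<subseteq> I \<times> J" "T \<subseteq> I \<times> J" using ferrers_subset D(1) D'(1) by blast+
  have first: "(i1, j1) \<in> S \<longleftrightarrow> (i1, j1) \<in> T"
    using small_rel_corner[OF small fin rest ne] small_rel_corner[OF small(2,1) fin rest[symmetric] ne]
    by blast
  have rest': "(I \<times> J - S) \<inter> (I - {i2, i1}) \<times> (J - {j2, j1}) = (I \<times> J - T) \<inter> (I - {i2, i1}) \<times> (J - {j2, j1})"
    using rest by blast
  have ne': "I - {i2, i1} \<noteq> {} \<or> J - {j2, j1} \<noteq> {}" using ne by blast
  note c = small_rel_complement[OF small(1)] small_rel_complement[OF small(2)]
  have "(i2, j2) \<in> I \<times> J - S \<longleftrightarrow> (i2, j2) \<in> I \<times> J - T"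
    using small_rel_corner[OF c fin rest' ne'] small_rel_corner[OF c(2,1) fin rest'[symmetric] ne']
    by blast
  then have last: "(i2, j2) \<in> S \<longleftrightarrow> (i2, j2) \<in> T" using D(3,5) by blast
  have "(r, c) \<in> S \<longleftrightarrow> (r, c) \<in> T" if rc: "r \<in> I" "c \<in> J" for r c
  proof -
    consider "r = i1" | "r = i2" | "c = j1" | "c = j2" | "r \<in> I - {i1, i2}" "c \<in> J - {j1, j2}"
      using rc by blast
    then show ?thesis
    proof cases
      case 1
      then show ?thesis using D(8)[of c] D'(8)[of c] first rc by blast
    next
      case 2
      then show ?thesis using D(10)[of c] D'(10)[of c] last by blast
    next
      case 3
      then show ?thesis using D(9)[of r] D'(9)[of r] first by blast
    next
      case 4
      then show ?thesis using D(11)[of r] D'(11)[of r] last rc by blast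
    next
      case 5
      then show ?thesis using rest by blast
    qed
  qed
  then show ?thesis using sub by auto
qed

lemma small_cell_eqI:
  assumes small: "small_rel {1..m} {1..n} i1 i2 j1 j2 S" "small_rel {1..m} {1..n} i1 i2 j1 j2 T"
    and rest: "S \<inter> ({1..m} - {i1, i2}) \<times> ({1..n} - {j1, j2}) = T \<inter> ({1..m} - {i1, i2}) \<times> ({1..n} - {j1, j2})"
  shows "cell m n (region m n S) = cell m n (region m n T)"
proof (cases "{1..m} - {i1, i2} \<noteq> {} \<or> {1..n} - {j1, j2} \<noteq> {}")
  case True
  then show ?thesis using small_rel_eqI[OF small _ _ rest] by simp
next
  case False
  then have "{1..m} = {i1, i2}" "{1..n} = {j1, j2}" using small_relD(2-5)[OF small(1)] by blast+
  then show ?thesis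
    unfolding cell_def using g_region_two_by_two[OF small(1)] g_region_two_by_two[OF small(2)] by simp
qed

lemma finite_ferrers: "finite I \<Longrightarrow> finite J \<Longrightarrow> finite (ferrers I J)"
  by (rule finite_subset[of _ "Pow (I \<times> J)"]) (auto simp: ferrers_def)

lemma card_ferrers_le:
  assumes f: "bij_betw f I I'" and h: "bij_betw h J J'" and fin: "finite I'" "finite J'"
  shows "card (ferrers I J) \<le> card (ferrers I' J')"
proof (rule card_inj_on_le[of "image (map_prod f h)"])
  have "inj_on (map_prod f h) (I \<times> J)"
    using f h by (intro map_prod_inj_on) (auto simp: bij_betw_def)
  then have "inj_on (image (map_prod f h)) (Pow (I \<times> J))" by (rule inj_on_image_Pow)
  then show "inj_on (image (map_prod f h)) (ferrers I J)"
    by (rule inj_on_subset) (auto simp: ferrers_def)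
  show "image (map_prod f h) ` ferrers I J \<subseteq> ferrers I' J'"
  proof (rule image_subsetI)
    fix S assume S: "S \<in> ferrers I J"
    have sub: "S \<subseteq> I \<times> J" using ferrers_subset[OF S] .
    have mem: "(f i, h j) \<in> map_prod f h ` S \<longleftrightarrow> (i, j) \<in> S" if "i \<in> I" "j \<in> J" for i j
    proof
      assume "(f i, h j) \<in> map_prod f h ` S"
      then obtain i' j' where "(i', j') \<in> S" "f i = f i'" "h j = h j'" by auto
      then show "(i, j) \<in> S" using f h that sub unfolding bij_betw_def inj_on_def by blast
    qed (rule rev_image_eqI, auto)
    have "map_prod f h ` S \<subseteq> I' \<times> J'" using sub f h unfolding bij_betw_def by auto
    moreover have "(x, w) \<in> map_prod f h ` S \<or> (z, y) \<in> map_prod f h ` S"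
      if xy: "(x, y) \<in> map_prod f h ` S" "(z, w) \<in> map_prod f h ` S" for x y z w
    proof -
      obtain i j k l where "(i, j) \<in> S" "(k, l) \<in> S" "x = f i" "y = h j" "z = f k" "w = h l"
        using xy by auto
      then show ?thesis using mem ferrersD[OF S, of i j k l] sub by blast
    qed
    ultimately show "map_prod f h ` S \<in> ferrers I' J'" unfolding ferrers_def by blast
  qed
qed (rule finite_ferrers[OF fin])

lemma card_ferrers:
  assumes "finite I" "finite J"
  shows "card (ferrers I J) = num_regions (card I) (card J)"
proof -
  obtain f h where f: "bij_betw f {1..card I} I" and h: "bij_betw h {1..card J} J"
    using assms ex_bij_betw_nat_finite_1 by blast
  have "card (ferrers I J) \<le> card (ferrers {1..card I} {1..card J})"
    by (rule card_ferrers_le[OF bij_betw_inv_into[OF f] bij_betw_inv_into[OF h]]) auto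
  moreover have "card (ferrers {1..card I} {1..card J}) \<le> card (ferrers I J)"
    by (rule card_ferrers_le[OF f h assms])
  ultimately show ?thesis unfolding num_regions_eq by simp
qed

lemma card_increasing_pairs: "card {(i, k). i \<in> {1..m} \<and> k \<in> {1..m} \<and> i < k} = m choose 2"
proof (induction m)
  case 0
  then show ?case by simp
next
  case (Suc m)
  let ?P = "\<lambda>m. {(i, k). i \<in> {1..m} \<and> k \<in> {1..m} \<and> i < k}"
  have eq: "?P (Suc m) = ?P m \<union> {1..m} \<times> {Suc m}" by (auto simp: le_Suc_eq)
  have "finite (?P m)" by (rule finite_subset[of _ "{1..m} \<times> {1..m}"]) auto
  then have "card (?P (Suc m)) = card (?P m) + card ({1..m} \<times> {Suc m})"
    unfolding eq by (intro card_Un_disjoint) auto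
  also have "\<dots> = (m choose 2) + m" using Suc.IH by simp
  also have "\<dots> = Suc m choose 2" using binomial_Suc_Suc[of m 1] by (simp add: numeral_2_eq_2)
  finally show ?case .
qed

lemma card_distinct_pairs: "card {(j, l). j \<in> {1..n} \<and> l \<in> {1..n} \<and> j \<noteq> l} = 2 * (n choose 2)"
proof (induction n)
  case 0
  then show ?case by simp
next
  case (Suc n)
  let ?P = "\<lambda>n. {(j, l). j \<in> {1..n} \<and> l \<in> {1..n} \<and> j \<noteq> l}"
  have eq: "?P (Suc n) = ?P n \<union> ({1..n} \<times> {Suc n} \<union> {Suc n} \<times> {1..n})" by (auto simp: le_Suc_eq)
  have "finite (?P n)" by (rule finite_subset[of _ "{1..n} \<times> {1..n}"]) auto
  then have "card (?P (Suc n)) = card (?P n) + card ({1..n} \<times> {Suc n} \<union> {Suc n} \<times> {1..n})"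
    unfolding eq by (intro card_Un_disjoint) auto
  also have "card ({1..n} \<times> {Suc n} \<union> {Suc n} \<times> {1..n}) = 2 * n"
    by (subst card_Un_disjoint) (auto simp: card_cartesian_product)
  also have "card (?P n) + 2 * n = 2 * (Suc n choose 2)"
    using Suc.IH binomial_Suc_Suc[of n 1] by (simp add: numeral_2_eq_2)
  finally show ?case .
qed

theorem proposition3:
  fixes m n :: nat
  assumes "m \<ge> 2" and "n \<ge> 2"
  shows "card (small_cells m n) =
    2 * (m choose 2) * (n choose 2) * num_regions (m - 2) (n - 2)"
proof -
  let ?I = "{1..m}" and ?J = "{1..n}"
  let ?rest = "\<lambda>i1 i2 j1 j2. (?I - {i1, i2}) \<times> (?J - {j1, j2})"
  define rows where "rows = {(i1, i2). i1 \<in> ?I \<and> i2 \<in> ?I \<and> i1 < i2}"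
  define cols where "cols = {(j1, j2). j1 \<in> ?J \<and> j2 \<in> ?J \<and> j1 \<noteq> j2}"
  define data where "data = (SIGMA ((i1, i2), (j1, j2)) : rows \<times> cols.
    ferrers (?I - {i1, i2}) (?J - {j1, j2}))"
  define P where "P = (\<lambda>(((i1, i2), (j1, j2)), F) S.
    small_rel ?I ?J i1 i2 j1 j2 S \<and> S \<inter> ?rest i1 i2 j1 j2 = F)"
  have "\<exists>S. P x S" if x: "x \<in> data" for x
  proof -
    obtain i1 i2 j1 j2 F where x_eq: "x = (((i1, i2), (j1, j2)), F)" by (metis surj_pair)
    have "i1 \<in> ?I" "i2 \<in> ?I" "j1 \<in> ?J" "j2 \<in> ?J" "i1 \<noteq> i2" "j1 \<noteq> j2"
      and "F \<in> ferrers (?I - {i1, i2}) (?J - {j1, j2})"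
      using x unfolding x_eq data_def rows_def cols_def by auto
    then show ?thesis using small_rel_extension[of F ?I i1 i2 ?J j1 j2] unfolding x_eq P_def by simp
  qed
  then obtain ext where ext: "\<And>x. x \<in> data \<Longrightarrow> P x (ext x)" by metis
  have data_I: "(((i1, i2), (j1, j2)), S \<inter> ?rest i1 i2 j1 j2) \<in> data"
    if "small_rel ?I ?J i1 i2 j1 j2 S" "i1 < i2" for i1 i2 j1 j2 S
  proof -
    note D = small_relD[OF that(1)]
    have "S \<inter> ?rest i1 i2 j1 j2 \<in> ferrers (?I - {i1, i2}) (?J - {j1, j2})"
      using D(1) unfolding ferrers_def by blast
    then show ?thesis
      using D(2-7) that(2) unfolding data_def rows_def cols_def by (simp del: atLeastAtMost_iff)
  qed
  have "bij_betw (\<lambda>x. cell m n (region m n (ext x))) data (small_cells m n)"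
    unfolding bij_betw_def
  proof
    show "inj_on (\<lambda>x. cell m n (region m n (ext x))) data"
    proof (rule inj_onI)
      fix x x' assume x: "x \<in> data" "x' \<in> data"
        and eq: "cell m n (region m n (ext x)) = cell m n (region m n (ext x'))"
      obtain i1 i2 j1 j2 F where x_eq: "x = (((i1, i2), (j1, j2)), F)" by (metis surj_pair)
      obtain i1' i2' j1' j2' F' where x'_eq: "x' = (((i1', i2'), (j1', j2')), F')" by (metis surj_pair)
      have "i1 < i2" "i1' < i2'" using x unfolding x_eq x'_eq data_def rows_def by auto
      moreover have "small_rel ?I ?J i1 i2 j1 j2 (ext x)" "ext x \<inter> ?rest i1 i2 j1 j2 = F"
        using ext[OF x(1)] unfolding P_def x_eq by auto
      moreover have "small_rel ?I ?J i1' i2' j1' j2' (ext x')" "ext x' \<inter> ?rest i1' i2' j1' j2' = F'"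
        using ext[OF x(2)] unfolding P_def x'_eq by auto
      ultimately show "x = x'"
        using small_cell_params_unique[of m n i1 i2 j1 j2 "ext x" i1' i2' j1' j2' "ext x'"] eq
        unfolding x_eq x'_eq by auto
    qed
    show "(\<lambda>x. cell m n (region m n (ext x))) ` data = small_cells m n"
    proof (intro equalityI subsetI)
      fix C assume "C \<in> (\<lambda>x. cell m n (region m n (ext x))) ` data"
      then obtain x where x: "x \<in> data" "C = cell m n (region m n (ext x))" by blast
      obtain i1 i2 j1 j2 F where x_eq: "x = (((i1, i2), (j1, j2)), F)" by (metis surj_pair)
      have "small_rel ?I ?J i1 i2 j1 j2 (ext x)" using ext[OF x(1)] unfolding P_def x_eq by simp
      then show "C \<in> small_cells m n" unfolding small_cells_eq[OF assms] x(2) by blast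
    next
      fix C assume "C \<in> small_cells m n"
      then obtain S i1 i2 j1 j2 where C: "C = cell m n (region m n S)"
        and small: "small_rel ?I ?J i1 i2 j1 j2 S" unfolding small_cells_eq[OF assms] by blast
      have *: "cell m n (region m n S) \<in> (\<lambda>x. cell m n (region m n (ext x))) ` data"
        if small: "small_rel ?I ?J i1 i2 j1 j2 S" and less: "i1 < i2" for i1 i2 j1 j2 S
      proof (rule image_eqI[OF _ data_I[OF small less]])
        show "cell m n (region m n S) =
            cell m n (region m n (ext (((i1, i2), (j1, j2)), S \<inter> ?rest i1 i2 j1 j2)))"
          using ext[OF data_I[OF small less]] unfolding P_def
          by (intro small_cell_eqI[OF small]) auto
      qed
      show "C \<in> (\<lambda>x. cell m n (region m n (ext x))) ` data"
      proof (cases "i1 < i2")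
        case True
        then show ?thesis using * small unfolding C by blast
      next
        case False
        then have "i2 < i1" using small_relD(6)[OF small] by simp
        then show ?thesis
          using *[OF small_rel_complement[OF small]] unfolding C cell_complement by blast
      qed
    qed
  qed
  then have "card (small_cells m n) = card data" by (simp add: bij_betw_same_card)
  also have "\<dots> = (\<Sum>x \<in> rows \<times> cols. num_regions (m - 2) (n - 2))"
  proof -
    have fin: "finite (rows \<times> cols)"
      by (rule finite_subset[of _ "(?I \<times> ?I) \<times> (?J \<times> ?J)"]) (auto simp: rows_def cols_def)
    have "card data = (\<Sum>((i1, i2), (j1, j2)) \<in> rows \<times> cols. card (ferrers (?I - {i1, i2}) (?J - {j1, j2})))"
      unfolding data_def using fin
      by (subst card_SigmaI) (auto intro!: finite_ferrers sum.cong)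
    also have "\<dots> = (\<Sum>x \<in> rows \<times> cols. num_regions (m - 2) (n - 2))"
    proof (rule sum.cong[OF refl], clarify)
      fix i1 i2 j1 j2 assume "(i1, i2) \<in> rows" "(j1, j2) \<in> cols"
      then have "card (?I - {i1, i2}) = m - 2" "card (?J - {j1, j2}) = n - 2"
        unfolding rows_def cols_def by (auto simp: card_Diff_subset)
      then show "card (ferrers (?I - {i1, i2}) (?J - {j1, j2})) = num_regions (m - 2) (n - 2)"
        by (subst card_ferrers) auto
    qed
    finally show ?thesis .
  qed
  also have "\<dots> = card rows * card cols * num_regions (m - 2) (n - 2)"
    by (simp add: card_cartesian_product)
  also have "card rows = m choose 2" unfolding rows_def by (rule card_increasing_pairs)
  also have "card cols = 2 * (n choose 2)" unfolding cols_def by (rule card_distinct_pairs)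
  finally show ?thesis by simp
qed

end
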